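(* Let $\Gamma\subset\Omega_0\times[0,\infty)$ satisfy the following: (a) $\mathsf{W}$-a.s. $0\in\Gamma$; (b) $\mathsf{W}$-a.s. $\Gamma$ is closed in the upper limit topology; (c) $\Gamma$ is progressive in the filtration $\mathcal{F}^{0,\rightarrow}=(\mathcal{F}_{0,t})_{t\in[0,\infty)}$; (d) for all real $u\ge0$, $\mathsf{W}$-a.s., for all $s$, if $s\in\Gamma\cap[u,\infty)$, then $\Gamma=u+\Gamma(\Delta_u)$ on $[s,\infty)$ (i.e. the two sets have the same intersection with $[s,\infty)$). For real $s\le t$ put $g_{s,t}:=s+\sup\big(\Gamma(\Delta_s)\cap[0,t-s]\big)\in[s,t]$ (with $\sup\emptyset:=0$), and put $$M:=\{g_{s,t}:(s,t)\in\mathbb{Q}^2,\ s<t,\ g_{s,t}\in(s,t)\}.$$ Then: (i) for all extended-real $s<t$ one has, $\mathsf{W}$-a.s., $M\cap(s,t)=\{g_{p,q}:(p,q)\in\mathbb{Q}^2,\ s\le p<q\le t,\ g_{p,q}\in(p,q)\}$; therefore the random countable set $M$ is local; (ii) $M$ is stationary.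
   Context: $\Omega_0:=\{\omega:\mathbb{R}\to\mathbb{R}\text{ continuous},\ \omega(0)=0\}$, with canonical process $B=(B_t)_{t\in\mathbb{R}}$. $\mathsf{W}$ is the completed two-sided Wiener measure: $(B_t)_{t\ge0}$ and $(B_{-t})_{t\ge 0}$ are independent standard Brownian motions under $\mathsf{W}$; its domain $\mathcal{G}$ is the $\mathsf{W}$-completion of the Borel $\sigma$-field of $\Omega_0$ (locally uniform topology). For extended-real $s<t$, $\mathcal{F}_{s,t}$ is the $\sigma$-field generated by the increments of $B$ between the times $s$ and $t$ and by all events of $\mathsf{W}$-probability $0$ or $1$ ($\mathcal{F}_{0,0}$ consists of the latter events only). For $u\in\mathbb{R}$ the Lévy shift $\Delta_u:\Omega_0\to\Omega_0$ is $\Delta_u(\omega)(t):=\omega(u+t)-\omega(u)$. A subset $\Gamma\subset\Omega_0\times[0,\infty)$ is identified with the map $\omega\mapsto\Gamma(\omega)=\{t:(\omega,t)\in\Gamma\}$, and $\Gamma(\Delta_u)$ is the composition of this map with $\Delta_u$. The upper limit topology is the one generated by the half-open intervals $(a,b]$. Progressive means $\Gamma\cap(\Omega_0\times[0,t])\in\mathcal{F}_{0,t}\otimes\mathcal{B}_{[0,t]}$ for every $t\ge 0$. $\dagger\notin\mathbb{R}$ is a coffin state; $\mathbb{R}^\dagger:=\mathbb{R}\cup\{\dagger\}$ with the $\sigma$-field generated by the Borel sets of $\mathbb{R}$ and $\{\dagger\}$. For a sequence $s=(s_i)_{i\in\mathbb{N}}$ in $\mathbb{R}^\dagger$, $[s]:=\{s_i:i\in\mathbb{N}\}\setminus\{\dagger\}$.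 For a sub-$\sigma$-field $\mathcal{A}$ of $\mathcal{G}$, an $\mathcal{A}$-measurable enumeration of a map $M:\Omega_0\to2^{\mathbb{R}}$ is a sequence $S=(S_i)_{i\in\mathbb{N}}$ of $\mathcal{A}$-measurable $\mathbb{R}^\dagger$-valued random variables with $M=[S]$ $\mathsf{W}$-a.s. $M$ is a random countable set if it has a $\mathcal{G}$-measurable enumeration; it is then local if for all extended-real $s<t$ the set $M\cap(s,t)$ has an $\mathcal{F}_{s,t}$-measurable enumeration, and stationary if for every $u\in\mathbb{R}$, $M=u+M(\Delta_u)$ $\mathsf{W}$-a.s. *)

theory Defs
  imports "HOL-Probability.Probability"
begin

definition path_space :: "(real \<Rightarrow> real) set" ("\<Omega>\<^sub>0") where
  "\<Omega>\<^sub>0 = {\<omega>. continuous_on UNIV \<omega> \<and> \<omega> 0 = 0}"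

(* Every basic neighbourhood of \<omega> controls the sup-distance on a compact set of times. *)
definition locally_uniform_open :: "(real \<Rightarrow> real) set \<Rightarrow> bool" where
  "locally_uniform_open U \<longleftrightarrow> U \<subseteq> \<Omega>\<^sub>0 \<and>
     (\<forall>\<omega>\<in>U. \<exists>K e. compact K \<and> e > 0 \<and>
        {\<omega>' \<in> \<Omega>\<^sub>0. \<forall>t\<in>K. \<bar>\<omega>' t - \<omega> t\<bar> < e} \<subseteq> U)"

definition path_borel :: "(real \<Rightarrow> real) measure" where
  "path_borel = sigma \<Omega>\<^sub>0 {U. locally_uniform_open U}"

definition standard_brownian_motion :: "'a measure \<Rightarrow> (real \<Rightarrow> 'a \<Rightarrow> real) \<Rightarrow> bool" where
  "standard_brownian_motion P X \<longleftrightarrow>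
     prob_space P \<and>
     (\<forall>t\<ge>0. X t \<in> borel_measurable P) \<and>
     (\<forall>\<omega>\<in>space P. X 0 \<omega> = 0 \<and> continuous_on {0..} (\<lambda>t. X t \<omega>)) \<and>
     (\<forall>s t. 0 \<le> s \<and> s < t \<longrightarrow>
        distributed P lborel (\<lambda>\<omega>. X t \<omega> - X s \<omega>) (normal_density 0 (sqrt (t - s)))) \<and>
     (\<forall>n (\<tau> :: nat \<Rightarrow> real). 0 \<le> \<tau> 0 \<and> (\<forall>i<n. \<tau> i \<le> \<tau> (Suc i)) \<longrightarrow>
        prob_space.indep_vars P (\<lambda>_. borel)
          (\<lambda>i \<omega>. X (\<tau> (Suc i)) \<omega> - X (\<tau> i) \<omega>) {..<n})"

(* The two halves of the path are independent as processes, i.e. as random elements of the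
   product space indexed by the half-line. The two-sided Wiener measure is the unique W with
   this property. *)
definition completed_two_sided_wiener :: "(real \<Rightarrow> real) measure \<Rightarrow> bool" where
  "completed_two_sided_wiener W \<longleftrightarrow>
     (\<exists>P. W = completion P \<and> prob_space P \<and>
        space P = \<Omega>\<^sub>0 \<and> sets P = sets path_borel \<and>
        standard_brownian_motion P (\<lambda>t \<omega>. \<omega> t) \<and>
        standard_brownian_motion P (\<lambda>t \<omega>. \<omega> (- t)) \<and>
        prob_space.indep_var P
          (\<Pi>\<^sub>M t\<in>{0..}. borel) (\<lambda>\<omega>. \<lambda>t\<in>{0..}. \<omega> t)
          (\<Pi>\<^sub>M t\<in>{0..}. borel) (\<lambda>\<omega>. \<lambda>t\<in>{0..}. \<omega> (- t)))"

definition increments_field ::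
    "(real \<Rightarrow> real) measure \<Rightarrow> ereal \<Rightarrow> ereal \<Rightarrow> (real \<Rightarrow> real) measure" where
  "increments_field W s t = sigma \<Omega>\<^sub>0
     ({(\<lambda>\<omega>. \<omega> b - \<omega> a) -` A \<inter> \<Omega>\<^sub>0 | a b A.
         s \<le> ereal a \<and> a \<le> b \<and> ereal b \<le> t \<and> A \<in> sets borel} \<union>
      {N \<in> sets W. measure W N = 0 \<or> measure W N = 1})"

definition levy_shift :: "real \<Rightarrow> (real \<Rightarrow> real) \<Rightarrow> real \<Rightarrow> real" where
  "levy_shift u \<omega> = (\<lambda>t. \<omega> (u + t) - \<omega> u)"

definition upper_limit_topology :: "real topology" where
  "upper_limit_topology = topology_generated_by {{a<..b} | a b. True}"

definition progressive :: "(real \<Rightarrow> real) measure \<Rightarrow> ((real \<Rightarrow> real) \<times> real) set \<Rightarrow> bool" where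
  "progressive W \<Gamma> \<longleftrightarrow>
     (\<forall>t\<ge>0. \<Gamma> \<inter> (\<Omega>\<^sub>0 \<times> {0..t}) \<in>
        sets (increments_field W 0 (ereal t) \<Otimes>\<^sub>M restrict_space borel {0..t}))"

(* None plays the role of the coffin state. *)
definition borel_coffin :: "real option measure" where
  "borel_coffin = sigma UNIV ({Some ` A | A. A \<in> sets borel} \<union> {{None}})"

definition seq_set :: "(nat \<Rightarrow> real option) \<Rightarrow> real set" where
  "seq_set s = {x. Some x \<in> range s}"

definition measurable_enumeration ::
    "(real \<Rightarrow> real) measure \<Rightarrow> (real \<Rightarrow> real) measure \<Rightarrow> ((real \<Rightarrow> real) \<Rightarrow> real set) \<Rightarrow>
     (nat \<Rightarrow> (real \<Rightarrow> real) \<Rightarrow> real option) \<Rightarrow> bool" where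
  "measurable_enumeration W \<A> M S \<longleftrightarrow>
     (\<forall>i. S i \<in> measurable \<A> borel_coffin) \<and> (AE \<omega> in W. M \<omega> = seq_set (\<lambda>i. S i \<omega>))"

definition random_countable_set ::
    "(real \<Rightarrow> real) measure \<Rightarrow> ((real \<Rightarrow> real) \<Rightarrow> real set) \<Rightarrow> bool" where
  "random_countable_set W M \<longleftrightarrow> (\<exists>S. measurable_enumeration W W M S)"

definition local_set ::
    "(real \<Rightarrow> real) measure \<Rightarrow> ((real \<Rightarrow> real) \<Rightarrow> real set) \<Rightarrow> bool" where
  "local_set W M \<longleftrightarrow> random_countable_set W M \<and>
     (\<forall>s t :: ereal. s < t \<longrightarrow>
        (\<exists>S. measurable_enumeration W (increments_field W s t) (\<lambda>\<omega>. M \<omega> \<inter> einterval s t) S))"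

definition stationary_set ::
    "(real \<Rightarrow> real) measure \<Rightarrow> ((real \<Rightarrow> real) \<Rightarrow> real set) \<Rightarrow> bool" where
  "stationary_set W M \<longleftrightarrow> random_countable_set W M \<and>
     (\<forall>u::real. AE \<omega> in W. M \<omega> = (+) u ` M (levy_shift u \<omega>))"

(* The case distinction implements the convention sup {} = 0. *)
definition last_point ::
    "((real \<Rightarrow> real) \<times> real) set \<Rightarrow> real \<Rightarrow> real \<Rightarrow> (real \<Rightarrow> real) \<Rightarrow> real" where
  "last_point \<Gamma> s t \<omega> =
     (let A = \<Gamma> `` {levy_shift s \<omega>} \<inter> {0..t - s} in s + (if A = {} then 0 else Sup A))"

definition last_points ::
    "((real \<Rightarrow> real) \<times> real) set \<Rightarrow> (real \<Rightarrow> real) \<Rightarrow> real set" where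
  "last_points \<Gamma> \<omega> = {last_point \<Gamma> s t \<omega> | s t.
     s \<in> \<rat> \<and> t \<in> \<rat> \<and> s < t \<and> last_point \<Gamma> s t \<omega> \<in> {s<..<t}}"

end

(* Write G p = p + Gamma(Delta_p), so that g_{p,q} = max (G p \<inter> [p, q]), the maximum being attained
   because G p is closed for the upper limit topology. Property (d), shifted by p, says that G p and
   G p' agree to the right of any point of G p in [p', \<infinity>). Hence if x = g_{p,q} and p < p' < x < q' \<le> q,
   then also x = g_{p',q'}. The endpoints may thus be moved into any dense countable set
   (the rationals in (s, t) for locality, the translate u + Rats for stationarity).
   The almost sure statements are transported along Delta_p by the shift invariance of the Wiener
   measure. That g_{p,q} is measurable for the increments field is a measurable projection theorem. *)
theory Submission
  imports Defs
begin

text \<open>The event that a last point exceeds \<open>y\<close> is an uncountable union over times,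
  the projection of a progressive set along \<open>{0..r}\<close>. Locality asks for more than
  measurability in the completed Borel field: the projection must stay in the field of increments.
  It does, because this field contains all null sets, so that the Wiener measure restricted to it is
  complete, and because \<open>{0..r}\<close> is compact. The Wiener measure is given through two
  independent halves glued at time 0, and a shift moves the gluing point. Invariance is therefore
  checked on increments over finite grids and then passed to Borel sets of paths, which are traces
  of the product field of the coordinates. Property (d) has its own null set for each
  \<open>u\<close>; only countably many endpoints are ever compared, so these null sets can be
  collected.\<close>

section \<open>Measurable projection\<close>

text \<open>Sets are analytic over the paving of measurable set-valued maps with finitely many values, all
  of them closed subsets of \<open>S\<close>; as \<open>J n \<sigma>\<close> depends on \<open>\<sigma> 0, \<dots>, \<sigma> n\<close> only, this is the usual Souslin
  operation. Representing finite unions of rectangles by simple functions makes the paving closed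
  under unions and intersections.\<close>

definition souslin_scheme ::
    "'a measure \<Rightarrow> 'b::metric_space set \<Rightarrow> (nat \<Rightarrow> (nat \<Rightarrow> nat) \<Rightarrow> 'a \<Rightarrow> 'b set) \<Rightarrow> bool" where
  "souslin_scheme M S J \<longleftrightarrow>
     (\<forall>n \<sigma>. simple_function M (J n \<sigma>)) \<and>
     (\<forall>n \<sigma>. \<forall>x\<in>space M. closed (J n \<sigma> x) \<and> J n \<sigma> x \<subseteq> S) \<and>
     (\<forall>n \<sigma> \<tau>. (\<forall>i\<le>n. \<sigma> i = \<tau> i) \<longrightarrow> J n \<sigma> = J n \<tau>)"

definition souslin_kernel ::
    "'a measure \<Rightarrow> (nat \<Rightarrow> (nat \<Rightarrow> nat) \<Rightarrow> 'a \<Rightarrow> 'b set) \<Rightarrow> ('a \<times> 'b) set" where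
  "souslin_kernel M J = {(x, y). x \<in> space M \<and> (\<exists>\<sigma>. \<forall>n. y \<in> J n \<sigma> x)}"

definition souslin :: "'a measure \<Rightarrow> 'b::metric_space set \<Rightarrow> ('a \<times> 'b) set \<Rightarrow> bool" where
  "souslin M S A \<longleftrightarrow> (\<exists>J. souslin_scheme M S J \<and> A = souslin_kernel M J)"

lemma simple_function_finite_UN:
  assumes "finite I" "\<And>i. i \<in> I \<Longrightarrow> simple_function M (f i)"
  shows "simple_function M (\<lambda>x. \<Union>i\<in>I. f i x)"
  using assms
proof (induction I)
  case empty
  then show ?case by simp
next
  case (insert i I)
  then have "simple_function M (\<lambda>x. f i x \<union> (\<Union>j\<in>I. f j x))"
    by (intro simple_function_compose2[where h = "(\<union>)"]) auto
  then show ?case by simp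
qed

lemma simple_function_finite_INT:
  assumes "finite I" "\<And>i. i \<in> I \<Longrightarrow> simple_function M (f i)"
  shows "simple_function M (\<lambda>x. \<Inter>i\<in>I. f i x)"
  using assms
proof (induction I)
  case empty
  then show ?case by simp
next
  case (insert i I)
  then have "simple_function M (\<lambda>x. f i x \<inter> (\<Inter>j\<in>I. f j x))"
    by (intro simple_function_compose2[where h = "(\<inter>)"]) auto
  then show ?case by simp
qed

text \<open>Koenig's lemma for branches below \<open>h\<close>: coordinate \<open>k\<close> takes
  finitely many values, so the pigeonhole principle fixes the coordinates one after another while
  infinitely many \<open>m\<close> survive. It supplies the limit branch in the capacitability
  argument.\<close>

lemma bounded_sequences_cluster:
  fixes \<tau> :: "nat \<Rightarrow> nat \<Rightarrow> nat"
  assumes "\<And>m i. \<tau> m i \<le> h i"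
  obtains \<sigma> where "\<And>k. infinite {m. \<forall>i<k. \<tau> m i = \<sigma> i}"
proof -
  have "\<exists>s. \<forall>k. infinite {m. \<forall>i<k. \<tau> m i = s k i} \<and> (\<forall>i<k. s (Suc k) i = s k i)"
  proof (rule dependent_nat_choice)
    show "\<exists>s. infinite {m. \<forall>i<0::nat. \<tau> m i = s i}" by simp
  next
    fix s :: "nat \<Rightarrow> nat" and k
    let ?A = "{m. \<forall>i<k. \<tau> m i = s i}"
    assume inf: "infinite ?A"
    have "finite ((\<lambda>m. \<tau> m k) ` ?A)"
      by (rule finite_subset[of _ "{..h k}"]) (use assms in auto)
    from pigeonhole_infinite[OF inf this]
    obtain m0 where "m0 \<in> ?A" "infinite {m\<in>?A. \<tau> m k = \<tau> m0 k}" by blast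
    moreover have "{m\<in>?A. \<tau> m k = \<tau> m0 k} = {m. \<forall>i<Suc k. \<tau> m i = (s(k := \<tau> m0 k)) i}"
      by (auto simp: less_Suc_eq)
    ultimately show "\<exists>s'. infinite {m. \<forall>i<Suc k. \<tau> m i = s' i} \<and> (\<forall>i<k. s' i = s i)"
      by (intro exI[of _ "s(k := \<tau> m0 k)"]) auto
  qed
  then obtain s where s: "\<And>k. infinite {m. \<forall>i<k. \<tau> m i = s k i}"
    "\<And>k i. i < k \<Longrightarrow> s (Suc k) i = s k i" by blast
  have stable: "i < k \<Longrightarrow> s k i = s (Suc i) i" for i k
    by (induction k) (auto simp: less_Suc_eq s(2))
  have "{m. \<forall>i<k. \<tau> m i = s k i} = {m. \<forall>i<k. \<tau> m i = s (Suc i) i}" for k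
    by (intro Collect_cong) (metis stable)
  then have "infinite {m. \<forall>i<k. \<tau> m i = s (Suc i) i}" for k
    using s(1)[of k] by simp
  then show thesis
    by (rule that)
qed

text \<open>\<open>X\<close> is squeezed between a measurable envelope \<open>E\<close> and a
  countable union of inner sets of the same finite measure. The difference of the two is null, and
  completeness makes the rest of \<open>X\<close> measurable.\<close>

lemma (in complete_measure) sets_if_inner_approximable:
  assumes X: "X \<subseteq> space M" and fin: "emeasure M (space M) \<noteq> \<infinity>"
    and inner: "\<And>c. c < outer_measure_of M X \<Longrightarrow> \<exists>F\<in>sets M. F \<subseteq> X \<and> c \<le> emeasure M F"
  shows "X \<in> sets M"
proof -
  obtain E where E: "E \<in> sets M" "X \<subseteq> E" "outer_measure_of M X = emeasure M E"
    using outer_measure_of_attain[OF X] by blast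
  let ?\<F> = "{F \<in> sets M. F \<subseteq> X}"
  have "?\<F> \<noteq> {}" by auto
  from ennreal_SUP_countable_SUP[OF this, of "emeasure M"] obtain f :: "nat \<Rightarrow> ennreal"
    where f: "range f \<subseteq> emeasure M ` ?\<F>" "Sup (emeasure M ` ?\<F>) = Sup (range f)"
    by auto
  have "\<exists>F. F \<in> ?\<F> \<and> f n = emeasure M F" for n
    using subsetD[OF f(1) rangeI[of f n]] by (auto simp: image_iff)
  then obtain F where F: "\<And>n. F n \<in> ?\<F>" "\<And>n. f n = emeasure M (F n)" by metis
  let ?U = "\<Union>n. F n"
  have U: "?U \<in> sets M" "?U \<subseteq> X" using F(1) by auto
  have "emeasure M E \<le> Sup (emeasure M ` ?\<F>)"
  proof (rule dense_le)
    fix c assume "c < emeasure M E"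
    then obtain F where "F \<in> ?\<F>" "c \<le> emeasure M F" using inner E(3) by auto
    then show "c \<le> Sup (emeasure M ` ?\<F>)" by (meson SUP_upper order_trans)
  qed
  also have "\<dots> \<le> emeasure M ?U"
    unfolding f(2) using U(1) by (intro SUP_least) (auto simp: F(2) intro!: emeasure_mono)
  finally have "emeasure M E \<le> emeasure M ?U" .
  moreover have "emeasure M E \<noteq> \<infinity>"
    using fin E(1) by (metis emeasure_space infinity_ennreal_def top.extremum_uniqueI)
  moreover have "emeasure M ?U \<le> emeasure M E"
    using E U by (intro emeasure_mono) auto
  ultimately have "emeasure M ?U = emeasure M E" "emeasure M ?U \<noteq> \<infinity>" by auto
  moreover have "?U \<subseteq> E" using E U by auto
  ultimately have "emeasure M (E - ?U) = 0"
    using emeasure_Diff[OF _ E(1) U(1)] by auto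
  then have "E - ?U \<in> null_sets M" using E U by auto
  then have "X - ?U \<in> sets M"
    using complete[of "X - ?U" "E - ?U"] E(2) by auto
  then have "?U \<union> (X - ?U) \<in> sets M" using U by blast
  then show ?thesis using U(2) by (simp add: Un_absorb1)
qed

text \<open>Choquet's capacitability argument for the outer measure of the projection: the coordinates of
  \<open>\<sigma>\<close> are bounded one after another by some \<open>h\<close> at the cost of an arbitrarily small loss of outer
  measure, and compactness of the sections and of \<open>{\<sigma>. \<sigma> \<le> h}\<close> turns the finite-level
  approximations \<open>B\<close> into a measurable subset of the projection.\<close>

lemma (in complete_measure) souslin_projection:
  fixes S :: "'b::heine_borel set"
  assumes fin: "emeasure M (space M) \<noteq> \<infinity>" and S: "compact S" and A: "souslin M S A"
  shows "fst ` A \<in> sets M"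
proof -
  obtain J where J': "souslin_scheme M S J" and A': "A = souslin_kernel M J"
    using A unfolding souslin_def by auto
  have J: "simple_function M (J n \<sigma>)"
    "x \<in> space M \<Longrightarrow> closed (J n \<sigma> x) \<and> J n \<sigma> x \<subseteq> S" for n \<sigma> x
    using J' unfolding souslin_scheme_def by auto
  have Jdep: "J n \<sigma> = J n \<tau>" if "\<And>i. i \<le> n \<Longrightarrow> \<sigma> i = \<tau> i" for n \<sigma> \<tau>
    using J' that unfolding souslin_scheme_def by blast
  have A_eq: "A = {(x, y). x \<in> space M \<and> (\<exists>\<sigma>. \<forall>n. y \<in> J n \<sigma> x)}"
    using A' unfolding souslin_kernel_def .
  define X where "X h k = {x\<in>space M. \<exists>\<sigma> y. (\<forall>i<k. \<sigma> i \<le> h i) \<and> (\<forall>n. y \<in> J n \<sigma> x)}"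
    for h :: "nat \<Rightarrow> nat" and k :: nat
  have X0: "fst ` A = X h 0" for h unfolding X_def A_eq by force
  have Xcong: "X h k = X h' k" if "\<And>i. i < k \<Longrightarrow> h i = h' i" for h h' k
    unfolding X_def using that by simp
  have Xsp: "X h k \<subseteq> space M" for h k unfolding X_def by auto
  \<comment> \<open>As \<open>m\<close> grows, the sets increase to \<open>X h k\<close>. Outer
    measure is continuous along increasing sequences of arbitrary sets, so some bound
    \<open>m\<close> on coordinate \<open>k\<close> keeps it above \<open>c\<close>.\<close>
  have step: "\<exists>m. c < outer_measure_of M (X (h(k := m)) (Suc k))" if c: "c < outer_measure_of M (X h k)" for c h k
  proof -
    have inc: "incseq (\<lambda>m. X (h(k := m)) (Suc k))"
      unfolding incseq_def X_def by (auto simp: less_Suc_eq) (metis le_trans nless_le)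
    have "(\<Union>m. X (h(k := m)) (Suc k)) = X h k"
      unfolding X_def by (auto simp: less_Suc_eq)
    then have "c < (SUP m. outer_measure_of M (X (h(k := m)) (Suc k)))"
      using c by (simp add: SUP_outer_measure_of_incseq[OF Xsp inc])
    then show ?thesis by (auto simp: less_SUP_iff)
  qed
  show ?thesis
  proof (rule sets_if_inner_approximable[OF _ fin])
    show "fst ` A \<subseteq> space M" using X0[of "\<lambda>_. 0"] Xsp[of "\<lambda>_. 0" 0] by (simp only:)
    fix c assume c: "c < outer_measure_of M (fst ` A)"
    have "\<exists>H. \<forall>k. c < outer_measure_of M (X (H k) k) \<and> (\<forall>i<k. H (Suc k) i = H k i)"
    proof (rule dependent_nat_choice)
      show "\<exists>h. c < outer_measure_of M (X h 0)" using c X0 by metis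
      fix h k assume "c < outer_measure_of M (X h k)"
      from step[OF this] obtain m where "c < outer_measure_of M (X (h(k := m)) (Suc k))" ..
      then show "\<exists>h'. c < outer_measure_of M (X h' (Suc k)) \<and> (\<forall>i<k. h' i = h i)"
        by (intro exI[of _ "h(k := m)"]) auto
    qed
    then obtain H where H: "\<And>k. c < outer_measure_of M (X (H k) k)"
      "\<And>k i. i < k \<Longrightarrow> H (Suc k) i = H k i" by blast
    have stable: "i < k \<Longrightarrow> H k i = H (Suc i) i" for i k
      by (induction k) (auto simp: less_Suc_eq H(2))
    define h where "h i = H (Suc i) i" for i
    have Xh: "c < outer_measure_of M (X h k)" for k
      using H(1)[of k] Xcong[of k "H k" h, unfolded h_def, OF stable] unfolding h_def by simp
    \<comment> \<open>Branches cut off after coordinate \<open>k\<close> and padded with 0, hence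
      finitely many. \<open>J n\<close> with \<open>n \<le> k\<close> does not see the padding, so
      \<open>B k\<close> is a simple function with closed values.\<close>
    define \<Sigma> where "\<Sigma> k = {\<sigma>. (\<forall>i\<le>k. \<sigma> i \<le> h i) \<and> (\<forall>i>k. \<sigma> i = 0)}" for k
    have fin\<Sigma>: "finite (\<Sigma> k)" for k
    proof -
      have "finite {\<sigma>. \<forall>i. (i \<in> {..k} \<longrightarrow> \<sigma> i \<in> {..Max (h ` {..k})}) \<and> (i \<notin> {..k} \<longrightarrow> \<sigma> i = 0)}"
        by (rule finite_set_of_finite_funs) auto
      then show ?thesis
        by (rule finite_subset[rotated])
           (auto simp: \<Sigma>_def intro: order_trans[OF _ Max_ge])
    qed
    define B where "B k x = (\<Union>\<sigma>\<in>\<Sigma> k. \<Inter>n\<in>{..k}. J n \<sigma> x)" for k x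
    define E where "E k = {x\<in>space M. B k x \<noteq> {}}" for k
    have "simple_function M (B k)" for k
      unfolding B_def by (intro simple_function_finite_UN simple_function_finite_INT fin\<Sigma> J) auto
    then have E: "E k \<in> sets M" for k
      using simple_functionD(2)[of M "B k" "- {{}}"] by (auto simp: E_def vimage_def Int_def conj_commute)
    have Bdec: "B (Suc k) x \<subseteq> B k x" for k x
    proof
      fix y assume "y \<in> B (Suc k) x"
      then obtain \<sigma> where \<sigma>: "\<sigma> \<in> \<Sigma> (Suc k)" "\<And>n. n \<le> Suc k \<Longrightarrow> y \<in> J n \<sigma> x"
        unfolding B_def by auto
      have "J n (\<sigma>(Suc k := 0)) = J n \<sigma>" if "n \<le> k" for n
        using that by (intro Jdep) auto
      moreover have "\<sigma>(Suc k := 0) \<in> \<Sigma> k" using \<sigma>(1) by (auto simp: \<Sigma>_def)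
      ultimately show "y \<in> B k x" unfolding B_def using \<sigma>(2) by (intro UN_I) auto
    qed
    \<comment> \<open>Shift of index: \<open>\<Sigma> k\<close> bounds the coordinates 0 to
      \<open>k\<close>, which are the \<open>Suc k\<close> coordinates bounded in
      \<open>X h (Suc k)\<close>.\<close>
    have XE: "X h (Suc k) \<subseteq> E k" for k
    proof
      fix x assume "x \<in> X h (Suc k)"
      then obtain \<sigma> y where *: "x \<in> space M" "\<forall>i<Suc k. \<sigma> i \<le> h i" "\<And>n. y \<in> J n \<sigma> x"
        unfolding X_def by auto
      have "J n (\<lambda>i. if i \<le> k then \<sigma> i else 0) = J n \<sigma>" if "n \<le> k" for n
        using that by (intro Jdep) auto
      then have "y \<in> B k x" unfolding B_def using *
        by (intro UN_I[of "\<lambda>i. if i \<le> k then \<sigma> i else 0"]) (auto simp: \<Sigma>_def)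
      with *(1) show "x \<in> E k" unfolding E_def by auto
    qed
    have "decseq E" using Bdec unfolding decseq_Suc_iff E_def by blast
    then have "(INF k. emeasure M (E k)) = emeasure M (\<Inter>k. E k)"
      using E fin by (intro INF_emeasure_decseq)
        (auto, metis emeasure_space infinity_ennreal_def top.extremum_uniqueI)
    moreover have "c \<le> emeasure M (E k)" for k
      using Xh[of "Suc k"] outer_measure_of_mono[OF XE[of k], of M] E by (auto intro: less_imp_le less_le_trans)
    ultimately have "c \<le> emeasure M (\<Inter>k. E k)" by (metis INF_greatest)
    \<comment> \<open>The compact sets \<open>B k x\<close> are nested and nonempty, hence share
      some \<open>y\<close>. Each level witnesses \<open>y\<close> by a truncated branch; a cluster
      branch \<open>\<sigma>\<close> agrees up to \<open>n\<close> with one of level at least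
      \<open>n\<close>, which puts \<open>y\<close> in \<open>J n \<sigma> x\<close>.\<close>
    moreover have "(\<Inter>k. E k) \<subseteq> fst ` A"
    proof
      fix x assume x: "x \<in> (\<Inter>k. E k)"
      then have xsp: "x \<in> space M" by (auto simp: E_def)
      have "closed (B k x)" for k
        unfolding B_def using J(2)[OF xsp] fin\<Sigma> by (intro closed_UN closed_INT) auto
      moreover have BS: "B k x \<subseteq> S" for k
        unfolding B_def using J(2)[OF xsp] by fastforce
      ultimately have "compact (B k x)" for k
        using S by (metis closed_Int_compact inf.absorb1)
      moreover have "B k x \<noteq> {}" for k using x by (auto simp: E_def)
      moreover have "m \<le> n \<Longrightarrow> B n x \<subseteq> B m x" for m n
        using Bdec by (rule lift_Suc_antimono_le)
      ultimately have "(\<Inter>k. B k x) \<noteq> {}" by (rule compact_nest)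
      then obtain y where y: "\<And>k. y \<in> B k x" by auto
      then have "\<forall>k. \<exists>\<tau>. \<tau> \<in> \<Sigma> k \<and> (\<forall>n\<le>k. y \<in> J n \<tau> x)" unfolding B_def by fastforce
      then obtain \<tau> where \<tau>: "\<And>k. \<tau> k \<in> \<Sigma> k" "\<And>n k. n \<le> k \<Longrightarrow> y \<in> J n (\<tau> k) x" by metis
      have "\<tau> m i \<le> h i" for m i
        using \<tau>(1)[of m] unfolding \<Sigma>_def by (cases "i \<le> m") auto
      then obtain \<sigma> where \<sigma>: "\<And>k. infinite {m. \<forall>i<k. \<tau> m i = \<sigma> i}"
        using bounded_sequences_cluster by blast
      have "y \<in> J n \<sigma> x" for n
      proof -
        obtain m where "m \<ge> n" "\<forall>i<Suc n. \<tau> m i = \<sigma> i"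
          using \<sigma>[of "Suc n"] unfolding infinite_nat_iff_unbounded_le by auto
        then show ?thesis using \<tau>(2)[of n m] Jdep[of n "\<tau> m" \<sigma>] by auto
      qed
      with xsp show "x \<in> fst ` A" unfolding A_eq by force
    qed
    ultimately show "\<exists>F\<in>sets M. F \<subseteq> fst ` A \<and> c \<le> emeasure M F"
      using E by (intro bexI[of _ "\<Inter>k. E k"]) auto
  qed
qed

section \<open>Closure properties of Souslin sets and product measurable sets\<close>

lemma souslin_simple:
  assumes "simple_function M f" "\<And>x. x \<in> space M \<Longrightarrow> closed (f x) \<and> f x \<subseteq> S"
  shows "souslin M S {(x, y). x \<in> space M \<and> y \<in> f x}"
  unfolding souslin_def
  by (rule exI[of _ "\<lambda>_ _. f"]) (use assms in \<open>auto simp: souslin_scheme_def souslin_kernel_def\<close>)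

text \<open>Coordinate 0 of a branch names the index of the set, and the rest runs through the
  scheme of that set. Level 0 is filled with the trivial value \<open>S\<close>, because level
  \<open>m\<close> of a scheme now reads coordinates up to \<open>Suc m\<close>.\<close>

lemma souslin_countable_UN:
  assumes S: "closed S" and A: "\<And>i::nat. souslin M S (A i)"
  shows "souslin M S (\<Union>i. A i)"
proof -
  obtain J where J: "\<And>i. souslin_scheme M S (J i)" and A_eq: "\<And>i. A i = souslin_kernel M (J i)"
    using A unfolding souslin_def by metis
  define J' where "J' n \<sigma> = (case n of 0 \<Rightarrow> \<lambda>_. S | Suc m \<Rightarrow> J (\<sigma> 0) m (\<lambda>i. \<sigma> (Suc i)))"
    for n and \<sigma> :: "nat \<Rightarrow> nat"
  have JS: "x \<in> space M \<Longrightarrow> J i n \<sigma> x \<subseteq> S" for i n \<sigma> x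
    using J unfolding souslin_scheme_def by blast
  have "souslin_scheme M S J'"
    unfolding souslin_scheme_def
  proof (intro conjI allI impI ballI)
    fix n :: nat and \<sigma> \<tau> :: "nat \<Rightarrow> nat" assume "\<forall>i\<le>n. \<sigma> i = \<tau> i"
    then show "J' n \<sigma> = J' n \<tau>"
      using J[of "\<sigma> 0"] unfolding souslin_scheme_def J'_def by (cases n) auto
  qed (use J S in \<open>auto simp: J'_def souslin_scheme_def split: nat.split\<close>)
  moreover have "(\<Union>i. A i) = souslin_kernel M J'"
  proof (intro equalityI subsetI)
    fix z assume "z \<in> (\<Union>i. A i)"
    then obtain i x y \<sigma> where z: "z = (x, y)" "x \<in> space M" "\<And>n. y \<in> J i n \<sigma> x"
      unfolding A_eq souslin_kernel_def by auto
    then have "y \<in> J' n (case_nat i \<sigma>) x" for n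
      unfolding J'_def using subsetD[OF JS[OF z(2)] z(3)] z(3) by (cases n) auto
    with z show "z \<in> souslin_kernel M J'" unfolding souslin_kernel_def by auto
  next
    fix z assume "z \<in> souslin_kernel M J'"
    then obtain x y \<sigma> where z: "z = (x, y)" "x \<in> space M" "\<And>n. y \<in> J' n \<sigma> x"
      unfolding souslin_kernel_def by auto
    have "y \<in> J (\<sigma> 0) n (\<lambda>i. \<sigma> (Suc i)) x" for n
      using z(3)[of "Suc n"] by (simp add: J'_def)
    with z show "z \<in> (\<Union>i. A i)" unfolding A_eq souslin_kernel_def by auto
  qed
  ultimately show ?thesis unfolding souslin_def by blast
qed

text \<open>A single branch codes one branch for each \<open>i\<close>, and level
  \<open>prod_encode (i, n)\<close> tests level \<open>n\<close> of the scheme of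
  \<open>A i\<close>. The pairing is monotone in its second argument, so this level reads only
  coordinates up to its own number.\<close>

lemma souslin_countable_INT:
  assumes A: "\<And>i::nat. souslin M S (A i)"
  shows "souslin M S (\<Inter>i. A i)"
proof -
  obtain J where J: "\<And>i. souslin_scheme M S (J i)" and A_eq: "\<And>i. A i = souslin_kernel M (J i)"
    using A unfolding souslin_def by metis
  define J' where "J' p \<sigma> = (case prod_decode p of (i, n) \<Rightarrow> J i n (\<lambda>m. \<sigma> (prod_encode (i, m))))"
    for p and \<sigma> :: "nat \<Rightarrow> nat"
  have mono: "prod_encode (i, m) \<le> prod_encode (i, n)" if "m \<le> n" for i m n
    using that by (induction n) (auto simp: prod_encode_def le_Suc_eq)
  have "souslin_scheme M S J'"
    unfolding souslin_scheme_def
  proof (intro conjI allI impI ballI)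
    fix p :: nat and \<sigma> \<tau> :: "nat \<Rightarrow> nat" assume *: "\<forall>i\<le>p. \<sigma> i = \<tau> i"
    obtain i n where p: "prod_decode p = (i, n)" by (cases "prod_decode p")
    then have "p = prod_encode (i, n)" by (metis prod_decode_inverse)
    then have "\<forall>m\<le>n. \<sigma> (prod_encode (i, m)) = \<tau> (prod_encode (i, m))"
      using * mono by auto
    then show "J' p \<sigma> = J' p \<tau>"
      using J[of i] unfolding souslin_scheme_def J'_def p by simp
  qed (use J in \<open>auto simp: J'_def souslin_scheme_def split: prod.split\<close>)
  moreover have "(\<Inter>i. A i) = souslin_kernel M J'"
  proof (intro equalityI subsetI)
    fix z assume z: "z \<in> (\<Inter>i. A i)"
    obtain x y where xy: "z = (x, y)" by (cases z)
    have "\<exists>\<sigma>. \<forall>n. y \<in> J i n \<sigma> x" for i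
      using z unfolding A_eq souslin_kernel_def xy by auto
    then obtain \<sigma> where \<sigma>: "\<And>i n. y \<in> J i n (\<sigma> i) x" by metis
    have "y \<in> J' p (\<lambda>q. case prod_decode q of (i, m) \<Rightarrow> \<sigma> i m) x" for p
      unfolding J'_def using \<sigma> by (auto split: prod.split)
    moreover have "x \<in> space M" using z unfolding A_eq souslin_kernel_def xy by auto
    ultimately show "z \<in> souslin_kernel M J'" unfolding souslin_kernel_def xy by blast
  next
    fix z assume "z \<in> souslin_kernel M J'"
    then obtain x y \<sigma> where z: "z = (x, y)" "x \<in> space M" "\<And>n. y \<in> J' n \<sigma> x"
      unfolding souslin_kernel_def by auto
    have "y \<in> J i n (\<lambda>m. \<sigma> (prod_encode (i, m))) x" for i n
      using z(3)[of "prod_encode (i, n)"] by (simp add: J'_def)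
    with z show "z \<in> (\<Inter>i. A i)" unfolding A_eq souslin_kernel_def by auto
  qed
  ultimately show ?thesis unfolding souslin_def by blast
qed

lemma souslin_rectangle:
  assumes "F \<in> sets M" "closed C" "C \<subseteq> S"
  shows "souslin M S (F \<times> C)"
proof -
  have "simple_function M (\<lambda>x. if x \<in> F then C else {})"
    using assms(1) by (intro simple_function_If_set) (auto simp: sets.Int_space_eq1)
  then have "souslin M S {(x, y). x \<in> space M \<and> y \<in> (if x \<in> F then C else {})}"
    by (rule souslin_simple) (use assms in auto)
  moreover have "{(x, y). x \<in> space M \<and> y \<in> (if x \<in> F then C else {})} = F \<times> C"
    using sets.sets_into_space[OF assms(1)] by (auto split: if_splits)
  ultimately show ?thesis by simp
qed

lemma souslin_Un:
  assumes "closed S" "souslin M S A" "souslin M S B"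
  shows "souslin M S (A \<union> B)"
proof -
  have "souslin M S (\<Union>i::nat. if i = 0 then A else B)"
    using assms by (intro souslin_countable_UN) auto
  moreover have "(\<Union>i::nat. if i = 0 then A else B) = A \<union> B"
    by (auto split: if_splits)
  ultimately show ?thesis by simp
qed

text \<open>Souslin sets are in general not closed under complements, so the induction over Borel
  sets carries a set together with its complement. It starts from closed \<open>C\<close>, whose
  complement is the countable union of the closed sets of points at distance at least
  \<open>1 / (n + 1)\<close> from \<open>C\<close>.\<close>

lemma souslin_rectangle_borel:
  fixes S :: "'b::metric_space set"
  assumes S: "closed S" and F: "F \<in> sets M" and B: "B \<in> sets (restrict_space borel S)"
  shows "souslin M S (F \<times> B) \<and> souslin M S (F \<times> (S - B))"
proof -
  let ?P = "\<lambda>B. souslin M S (F \<times> (S \<inter> B)) \<and> souslin M S (F \<times> (S - B))"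
  have "?P B" if "B \<in> sigma_sets UNIV {C :: 'b set. closed C}" for B
    using that
  proof (induction B)
    case (Basic C)
    then have C: "closed C" by auto
    have "souslin M S (F \<times> (S - C))"
    \<comment> \<open>\<open>infdist\<close> to the empty set is 0 by convention, so the distance
      argument is kept for nonempty \<open>C\<close>.\<close>
    proof (cases "C = {}")
      case True
      with souslin_rectangle[OF F S order_refl] show ?thesis by simp
    next
      case False
      have "S - C = (\<Union>n. S \<inter> {x. inverse (Suc n) \<le> infdist x C})"
      proof (intro equalityI subsetI)
        fix x assume x: "x \<in> S - C"
        then have "0 < infdist x C"
          using C False by (metis DiffD2 in_closed_iff_infdist_zero infdist_nonneg less_eq_real_def)
        then obtain n where "inverse (Suc n) < infdist x C" using reals_Archimedean by blast
        then have "inverse (real (Suc n)) \<le> infdist x C" by simp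
        with x show "x \<in> (\<Union>n. S \<inter> {x. inverse (Suc n) \<le> infdist x C})" by blast
      next
        fix x assume "x \<in> (\<Union>n. S \<inter> {x. inverse (Suc n) \<le> infdist x C})"
        then obtain n where "x \<in> S" "inverse (real (Suc n)) \<le> infdist x C" by auto
        moreover have "0 < inverse (real (Suc n))" by simp
        ultimately have "x \<in> S" "infdist x C \<noteq> 0" by linarith+
        then show "x \<in> S - C" by auto
      qed
      then have eq: "F \<times> (S - C) = (\<Union>n. F \<times> (S \<inter> {x. inverse (Suc n) \<le> infdist x C}))"
        by auto
      show ?thesis unfolding eq
        by (intro souslin_countable_UN souslin_rectangle F S closed_Int closed_Collect_le)
           (auto intro: continuous_intros)
    qed
    then show ?case using souslin_rectangle[OF F closed_Int[OF S C]] by auto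
  next
    case Empty
    show ?case using souslin_rectangle[OF F S] souslin_rectangle[OF F, of "{}" S] by simp
  next
    case (Compl B)
    moreover have "S \<inter> (UNIV - B) = S - B" "S - (UNIV - B) = S \<inter> B" by auto
    ultimately show ?case by simp
  next
    case (Union B)
    have "F \<times> (S \<inter> (\<Union>i. B i)) = (\<Union>i. F \<times> (S \<inter> B i))"
      "F \<times> (S - (\<Union>i. B i)) = (\<Inter>i. F \<times> (S - B i))" by auto
    then show ?case using souslin_countable_UN[OF S] souslin_countable_INT Union by metis
  qed
  moreover obtain B' where "B' \<in> sets (borel :: 'b measure)" "B = S \<inter> B'"
    using B unfolding sets_restrict_space by auto
  moreover have "S - S \<inter> B' = S - B'" by auto
  ultimately show ?thesis by (auto simp: borel_eq_closed)
qed

text \<open>The same induction with complements, over the product field: outside a rectangle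
  \<open>F \<times> B\<close>, a point has its second coordinate in \<open>S - B\<close> or its
  first outside \<open>F\<close>, and both parts are Souslin.\<close>

lemma souslin_sets_pair:
  fixes S :: "'b::metric_space set"
  assumes S: "closed S" and A: "A \<in> sets (M \<Otimes>\<^sub>M restrict_space borel S)"
  shows "souslin M S A"
proof -
  have "A \<in> sigma_sets (space M \<times> S) {F \<times> B | F B. F \<in> sets M \<and> B \<in> sets (restrict_space borel S)}"
    using A by (simp add: sets_pair_measure space_restrict_space)
  then have "souslin M S A \<and> souslin M S (space M \<times> S - A)"
  proof (induction A)
    case (Basic A)
    then obtain F B where FB: "A = F \<times> B" "F \<in> sets M" "B \<in> sets (restrict_space borel S)" by auto
    then have "space M \<times> S - A = F \<times> (S - B) \<union> (space M - F) \<times> S"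
      using sets.sets_into_space[OF FB(2)] by auto
    moreover have "souslin M S ((space M - F) \<times> S)"
      using FB S by (intro souslin_rectangle) auto
    ultimately show ?case
      using souslin_rectangle_borel[OF S FB(2,3)] FB(1) by (auto intro: souslin_Un S)
  next
    case Empty
    show ?case
      using souslin_rectangle[of "space M" M S S] souslin_rectangle[of "{}" M S S] S by simp
  next
    case (Compl A)
    have "A \<subseteq> space M \<times> S"
      using sigma_sets_into_sp[OF _ Compl.hyps] sets.sets_into_space[of _ M]
        sets.sets_into_space[of _ "restrict_space borel S"]
      by (fastforce simp: space_restrict_space)
    then show ?case using Compl by (simp add: double_diff)
  next
    case (Union A)
    have "space M \<times> S - (\<Union>i. A i) = (\<Inter>i. space M \<times> S - A i)" by auto
    then show ?case
      using Union.IH souslin_countable_UN[OF S, of M A] souslin_countable_INT[of M S "\<lambda>i. space M \<times> S - A i"]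
      by simp
  qed
  then show ?thesis ..
qed

theorem (in complete_measure) measurable_projection:
  fixes S :: "'b::heine_borel set"
  assumes "emeasure M (space M) \<noteq> \<infinity>" "compact S" "A \<in> sets (M \<Otimes>\<^sub>M restrict_space borel S)"
  shows "fst ` A \<in> sets M"
  using assms by (intro souslin_projection souslin_sets_pair compact_imp_closed)

section \<open>Path space and shift invariance of the Wiener measure\<close>

lemma continuous_abs_le_if_Rats:
  fixes f :: "real \<Rightarrow> real"
  assumes f: "continuous_on UNIV f" and le: "\<And>q. q \<in> \<rat> \<Longrightarrow> \<bar>q\<bar> \<le> n \<Longrightarrow> \<bar>f q\<bar> \<le> c" and t: "\<bar>t\<bar> < n"
  shows "\<bar>f t\<bar> \<le> c"
proof (rule ccontr)
  assume "\<not> \<bar>f t\<bar> \<le> c"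
  then have tc: "c < \<bar>f t\<bar>" by simp
  have "open ({t. c < \<bar>f t\<bar>} \<inter> {t. \<bar>t\<bar> < n})"
    using f by (intro open_Int open_Collect_less continuous_intros)
  moreover have "t \<in> {t. c < \<bar>f t\<bar>} \<inter> {t. \<bar>t\<bar> < n}"
    using t tc by simp
  ultimately obtain e where e: "e > 0" "ball t e \<subseteq> {t. c < \<bar>f t\<bar>} \<inter> {t. \<bar>t\<bar> < n}"
    by (elim openE)
  obtain q where q: "q \<in> \<rat>" "t < q" "q < t + e" using Rats_dense_in_real[of t "t + e"] e(1) by auto
  then have "q \<in> ball t e" by (auto simp: dist_real_def)
  then have "c < \<bar>f q\<bar>" "\<bar>q\<bar> < n" using e(2) by auto
  then show False using le[OF q(1)] by simp
qed

lemma path_space_continuous: "\<omega> \<in> \<Omega>\<^sub>0 \<Longrightarrow> continuous_on A \<omega>"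
  unfolding path_space_def by (auto intro: continuous_on_subset)

text \<open>Every open set of paths is the union of the countably many tubes around rational step functions
  that it contains; with step functions as centres no separability of the path space is needed.\<close>

definition rational_step :: "nat \<Rightarrow> nat \<Rightarrow> rat list \<Rightarrow> real \<Rightarrow> real" where
  "rational_step n m l t = of_rat (l ! nat \<lfloor>(t + n) * m\<rfloor>)"

definition step_tube :: "nat \<Rightarrow> nat \<Rightarrow> rat list \<Rightarrow> nat \<Rightarrow> (real \<Rightarrow> real) set" where
  "step_tube n m l j = {\<omega> \<in> \<Omega>\<^sub>0. \<forall>t\<in>\<rat>. \<bar>t\<bar> \<le> real n \<longrightarrow> \<bar>\<omega> t - rational_step n m l t\<bar> \<le> inverse (Suc j)}"

text \<open>Half of \<open>e\<close> pays for the oscillation of \<open>\<omega>\<close> within a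
  cell of length \<open>1 / m\<close>, the other half for rounding the value at the left end of the
  cell to a rational.\<close>

lemma rational_step_approx:
  assumes \<omega>: "continuous_on UNIV \<omega>" and e: "e > 0"
  obtains m l where "\<And>t. \<bar>t\<bar> \<le> real n \<Longrightarrow> \<bar>\<omega> t - rational_step n m l t\<bar> \<le> e"
proof -
  have "uniformly_continuous_on {-real n..real n} \<omega>"
    using \<omega> by (intro compact_uniformly_continuous) (auto intro: continuous_on_subset)
  then obtain d where d: "d > 0"
    "\<And>s t. s \<in> {-real n..real n} \<Longrightarrow> t \<in> {-real n..real n} \<Longrightarrow> dist t s < d \<Longrightarrow> dist (\<omega> t) (\<omega> s) < e / 2"
    using e unfolding uniformly_continuous_on_def by (metis half_gt_zero)
  obtain m0 where m0: "inverse (real (Suc m0)) < d" using reals_Archimedean[OF d(1)] by blast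
  define m where "m = Suc m0"
  have "\<exists>r::rat. \<bar>\<omega> x - of_rat r\<bar> < e / 2" for x
  proof -
    obtain q where "q \<in> \<rat>" "\<omega> x - e / 2 < q" "q < \<omega> x" using Rats_dense_in_real[of "\<omega> x - e/2" "\<omega> x"] e by auto
    moreover then obtain r where "q = of_rat r" by (auto elim: Rats_cases)
    ultimately show ?thesis by (intro exI[of _ r]) (auto simp: abs_if)
  qed
  then obtain r :: "real \<Rightarrow> rat" where r: "\<And>x. \<bar>\<omega> x - of_rat (r x)\<bar> < e / 2" by metis
  \<comment> \<open>Entry \<open>i\<close> belongs to the cell with left end
    \<open>i / m - n\<close>; the range includes \<open>2 * n * m\<close>, the index on which
    \<open>t = n\<close> falls.\<close>
  define l where "l = map (\<lambda>i. r (i / m - n)) [0..<Suc (2 * n * m)]"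
  have "\<bar>\<omega> t - rational_step n m l t\<bar> \<le> e" if t: "\<bar>t\<bar> \<le> real n" for t
  proof -
    define i where "i = nat \<lfloor>(t + n) * m\<rfloor>"
    have nn: "0 \<le> (t + n) * m" using t by auto
    then have i: "real i \<le> (t + n) * m" "(t + n) * m < real i + 1" unfolding i_def by linarith+
    have "(t + n) * m \<le> (2 * real n) * real m" using t by (intro mult_right_mono) auto
    then have "real i \<le> real (2 * n * m)" using i(1) by simp
    then have "i \<le> 2 * n * m" by linarith
    then have "rational_step n m l t = of_rat (r (i / m - n))"
      unfolding rational_step_def i_def[symmetric] l_def by (subst nth_map) (auto simp del: upt_Suc)
    moreover have mp: "real m > 0" by (simp add: m_def)
    have "i / m - n \<le> t" using i(1) mp by (simp add: field_simps)
    moreover have "t < i / m - n + 1 / m" using i(2) mp by (simp add: field_simps)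
    moreover have "1 / real m < d" using m0 by (simp add: m_def inverse_eq_divide)
    moreover have "0 \<le> real i / real m" by simp
    ultimately have "dist (\<omega> t) (\<omega> (i / m - n)) < e / 2"
      using t by (intro d(2)) (auto simp: dist_real_def)
    with r[of "i / m - n"] show ?thesis
      using \<open>rational_step n m l t = _\<close> unfolding dist_real_def by linarith
  qed
  then show thesis by (rule that)
qed

text \<open>The half-width of the tube is below \<open>e / 2\<close>, so its members differ from
  \<open>\<omega>\<close> by less than \<open>e\<close> at rational times. Continuity extends this
  to \<open>K\<close>, which is why \<open>n\<close> is chosen strictly beyond
  \<open>K\<close>.\<close>

lemma locally_uniform_open_contains_tube:
  assumes U: "locally_uniform_open U" and \<omega>: "\<omega> \<in> U"
  shows "\<exists>n m l j. \<omega> \<in> step_tube n m l j \<and> step_tube n m l j \<subseteq> U"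
proof -
  obtain K e where K: "compact K" and e: "e > 0"
    and KU: "{\<omega>' \<in> \<Omega>\<^sub>0. \<forall>t\<in>K. \<bar>\<omega>' t - \<omega> t\<bar> < e} \<subseteq> U" and \<omega>0: "\<omega> \<in> \<Omega>\<^sub>0"
    using U \<omega> unfolding locally_uniform_open_def by blast
  obtain b where "\<And>t. t \<in> K \<Longrightarrow> \<bar>t\<bar> \<le> b"
    using compact_imp_bounded[OF K] unfolding bounded_iff by auto
  moreover obtain n :: nat where "b < n" using reals_Archimedean2 by blast
  ultimately have n: "\<And>t. t \<in> K \<Longrightarrow> \<bar>t\<bar> < n" by force
  obtain j where j: "inverse (real (Suc j)) < e / 2" using reals_Archimedean[of "e / 2"] e by auto
  obtain m l where ml: "\<And>t. \<bar>t\<bar> \<le> real n \<Longrightarrow> \<bar>\<omega> t - rational_step n m l t\<bar> \<le> inverse (Suc j)"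
    using rational_step_approx[OF path_space_continuous[OF \<omega>0], of "inverse (Suc j)"] by auto
  have "\<omega> \<in> step_tube n m l j" using ml \<omega>0 unfolding step_tube_def by auto
  moreover have "step_tube n m l j \<subseteq> U"
  proof
    fix \<omega>' assume \<omega>': "\<omega>' \<in> step_tube n m l j"
    then have \<omega>'0: "\<omega>' \<in> \<Omega>\<^sub>0" by (simp add: step_tube_def)
    have "\<bar>\<omega>' t - \<omega> t\<bar> < e" if "t \<in> K" for t
    proof -
      have "\<bar>\<omega>' q - \<omega> q\<bar> \<le> 2 * inverse (Suc j)" if q: "q \<in> \<rat>" "\<bar>q\<bar> \<le> real n" for q
      proof -
        have "\<bar>\<omega>' q - rational_step n m l q\<bar> \<le> inverse (Suc j)" using \<omega>' q by (auto simp: step_tube_def)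
        then show ?thesis using ml[OF q(2)] by linarith
      qed
      moreover have "continuous_on UNIV (\<lambda>t. \<omega>' t - \<omega> t)"
        by (intro continuous_intros path_space_continuous \<omega>0 \<omega>'0)
      ultimately have "\<bar>\<omega>' t - \<omega> t\<bar> \<le> 2 * inverse (Suc j)"
        using continuous_abs_le_if_Rats[of "\<lambda>t. \<omega>' t - \<omega> t" "real n" _ t] n[OF that] by blast
      then show ?thesis using j by linarith
    qed
    with KU \<omega>'0 show "\<omega>' \<in> U" by auto
  qed
  ultimately show ?thesis by blast
qed

text \<open>A tube tests rational times only, so it is a countable intersection of coordinate
  events, and its parameters are countably many. Laws on path space can thus be compared through
  finite-dimensional marginals.\<close>

lemma sets_path_borel_subset:
  "sets path_borel \<subseteq> sets (restrict_space (PiM UNIV (\<lambda>_. borel)) \<Omega>\<^sub>0)"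
proof -
  let ?R = "restrict_space (PiM UNIV (\<lambda>_::real. borel :: real measure)) \<Omega>\<^sub>0"
  have tube: "step_tube n m l j \<in> sets ?R" for n m l j
  proof -
    have "step_tube n m l j = \<Omega>\<^sub>0 \<inter>
        (\<Inter>t\<in>{t\<in>\<rat>. \<bar>t\<bar> \<le> real n}. {\<omega> \<in> space (PiM UNIV (\<lambda>_. borel)). \<bar>\<omega> t - rational_step n m l t\<bar> \<le> inverse (Suc j)})"
      unfolding step_tube_def by (auto simp: space_PiM)
    moreover have "countable {t\<in>\<rat>. \<bar>t\<bar> \<le> real n}"
      by (rule countable_subset[OF _ countable_rat]) auto
    moreover have "{t\<in>\<rat>. \<bar>t\<bar> \<le> real n} \<noteq> {}" by (auto intro: exI[of _ 0])
    ultimately show ?thesis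
      unfolding sets_restrict_space by (auto intro!: image_eqI[OF refl] sets.countable_INT')
  qed
  have "U \<in> sets ?R" if U: "locally_uniform_open U" for U
  proof -
    let ?D = "{(n, m, l, j). step_tube n m l j \<subseteq> U}"
    have "U = (\<Union>(n, m, l, j)\<in>?D. step_tube n m l j)"
      using locally_uniform_open_contains_tube[OF U] by fast
    moreover have "(\<Union>(n, m, l, j)\<in>?D. step_tube n m l j) \<in> sets ?R"
      using tube by (intro sets.countable_UN') auto
    ultimately show ?thesis by simp
  qed
  moreover have "space ?R = \<Omega>\<^sub>0" by (simp add: space_restrict_space space_PiM)
  moreover have "{U. locally_uniform_open U} \<subseteq> Pow \<Omega>\<^sub>0" by (auto simp: locally_uniform_open_def)
  ultimately show ?thesis
    unfolding path_borel_def by (metis (no_types, lifting) mem_Collect_eq sets.sigma_sets_subset sets_measure_of subsetI)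
qed

section \<open>Increments of the two-sided Brownian path\<close>

abbreviation normal_law :: "real \<Rightarrow> real measure" where
  "normal_law v \<equiv> density lborel (\<lambda>x. ennreal (normal_density 0 (sqrt v) x))"

lemma standard_brownian_motion_increments:
  assumes X: "standard_brownian_motion P X"
    and \<tau>: "0 \<le> \<tau> 0" "\<And>i. i < n \<Longrightarrow> \<tau> i < \<tau> (Suc i)"
    and A: "\<And>i. i < n \<Longrightarrow> A i \<in> sets borel"
  shows "measure P {\<omega> \<in> space P. \<forall>i<n. X (\<tau> (Suc i)) \<omega> - X (\<tau> i) \<omega> \<in> A i} =
    (\<Prod>i<n. measure (normal_law (\<tau> (Suc i) - \<tau> i)) (A i))"
proof (cases "n = 0")
  case True
  interpret prob_space P using X unfolding standard_brownian_motion_def by simp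
  show ?thesis using True prob_space by simp
next
  case False
  interpret prob_space P using X unfolding standard_brownian_motion_def by simp
  have nonneg: "0 \<le> \<tau> i" if "i < n" for i
    using that
  proof (induction i)
    case (Suc i)
    then show ?case using \<tau>(2)[of i] by simp
  qed (use \<tau>(1) in simp)
  let ?Y = "\<lambda>i \<omega>. X (\<tau> (Suc i)) \<omega> - X (\<tau> i) \<omega>"
  have ind: "indep_vars (\<lambda>_. borel) ?Y {..<n}"
    using X \<tau>(1) less_imp_le[OF \<tau>(2)] unfolding standard_brownian_motion_def by blast
  have D: "distributed P lborel (?Y i) (normal_density 0 (sqrt (\<tau> (Suc i) - \<tau> i)))" if "i < n" for i
    using X \<tau>(2)[OF that] nonneg[OF that] unfolding standard_brownian_motion_def by simp
  have "{\<omega> \<in> space P. \<forall>i<n. ?Y i \<omega> \<in> A i} = (\<Inter>i\<in>{..<n}. ?Y i -` A i \<inter> space P)"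
    using False by auto
  then have "prob {\<omega> \<in> space P. \<forall>i<n. ?Y i \<omega> \<in> A i} = (\<Prod>i<n. prob (?Y i -` A i \<inter> space P))"
    using indep_varsD_finite[OF ind, of A] False A by auto
  also have "\<dots> = (\<Prod>i<n. measure (normal_law (\<tau> (Suc i) - \<tau> i)) (A i))"
  proof (rule prod.cong[OF refl])
    fix i assume "i \<in> {..<n}"
    then have i: "i < n" by simp
    show "prob (?Y i -` A i \<inter> space P) = measure (normal_law (\<tau> (Suc i) - \<tau> i)) (A i)"
      unfolding distributed_distr_eq_density[OF D[OF i], symmetric]
      using distributed_measurable[OF D[OF i]] A[OF i] by (subst measure_distr) auto
  qed
  finally show ?thesis .
qed

text \<open>Symmetry of the centred normal law; it absorbs the change of sign of increments under
  time reversal.\<close>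

lemma measure_normal_law_uminus:
  assumes v: "v > 0" and A: "A \<in> sets borel"
  shows "measure (normal_law v) (uminus -` A) = measure (normal_law v) A"
proof -
  interpret N: prob_space "normal_law v" using v by (intro prob_space_normal_density) simp
  have "distributed (normal_law v) lborel (\<lambda>x. x) (normal_density 0 (sqrt v))"
    unfolding distributed_def by (auto simp: distr_id2)
  from N.normal_density_affine[OF this, of "-1" 0] v
  have D: "distributed (normal_law v) lborel uminus (normal_density 0 (sqrt v))" by simp
  show ?thesis
    using arg_cong[OF distributed_distr_eq_density[OF D], of "\<lambda>N. measure N A"]
      distributed_measurable[OF D] A by (subst (asm) measure_distr) auto
qed

locale two_sided_bm = prob_space P for P :: "(real \<Rightarrow> real) measure" +
  assumes space_P [simp]: "space P = \<Omega>\<^sub>0" and sets_P: "sets P = sets path_borel"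
    and bm: "standard_brownian_motion P (\<lambda>t \<omega>. \<omega> t)"
    and bm_neg: "standard_brownian_motion P (\<lambda>t \<omega>. \<omega> (- t))"
    and halves_indep: "indep_var
          (\<Pi>\<^sub>M t\<in>{0..}. borel) (\<lambda>\<omega>. \<lambda>t\<in>{0..}. \<omega> t)
          (\<Pi>\<^sub>M t\<in>{0..}. borel) (\<lambda>\<omega>. \<lambda>t\<in>{0..}. \<omega> (- t))"
begin

lemma coordinate_measurable [measurable]: "(\<lambda>\<omega>. \<omega> t) \<in> borel_measurable P"
proof (cases "0 \<le> t")
  case True
  then show ?thesis using bm unfolding standard_brownian_motion_def by auto
next
  case False
  then have "(\<lambda>\<omega>. \<omega> (- (- t))) \<in> borel_measurable P"
    using bm_neg unfolding standard_brownian_motion_def by (meson le_minus_iff linear neg_0_le_iff_le)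
  then show ?thesis by simp
qed

text \<open>The times \<open>- \<tau> (k - i)\<close> form an increasing grid for the half
  \<open>t \<mapsto> \<omega> (- t)\<close>. Its increment \<open>i\<close> is the negative of
  increment \<open>k - Suc i\<close> over \<open>\<tau>\<close>, hence the reflected sets
  \<open>A'\<close> and the reversed product.\<close>

lemma negative_increments:
  assumes \<tau>: "\<tau> k \<le> 0" "\<And>i. i < k \<Longrightarrow> \<tau> i < \<tau> (Suc i)"
    and A: "\<And>i. i < k \<Longrightarrow> A i \<in> sets borel"
  shows "prob {\<omega> \<in> \<Omega>\<^sub>0. \<forall>i<k. \<omega> (\<tau> (Suc i)) - \<omega> (\<tau> i) \<in> A i} =
    (\<Prod>i<k. measure (normal_law (\<tau> (Suc i) - \<tau> i)) (A i))"
proof -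
  define \<tau>' where "\<tau>' i = - \<tau> (k - i)" for i
  define A' where "A' i = uminus -` A (k - Suc i)" for i
  have inc: "\<tau>' (Suc i) - \<tau>' i = \<tau> (Suc (k - Suc i)) - \<tau> (k - Suc i)" if "i < k" for i
    using that by (simp add: \<tau>'_def Suc_diff_Suc)
  have "prob {\<omega> \<in> \<Omega>\<^sub>0. \<forall>i<k. \<omega> (- \<tau>' (Suc i)) - \<omega> (- \<tau>' i) \<in> A' i} =
    (\<Prod>i<k. measure (normal_law (\<tau>' (Suc i) - \<tau>' i)) (A' i))"
  proof (rule standard_brownian_motion_increments[OF bm_neg, unfolded space_P])
    show "0 \<le> \<tau>' 0" using \<tau>(1) by (simp add: \<tau>'_def)
    show "\<tau>' i < \<tau>' (Suc i)" if "i < k" for i using \<tau>(2)[of "k - Suc i"] inc[OF that] that by simp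
    show "A' i \<in> sets borel" if "i < k" for i
      unfolding A'_def using A[of "k - Suc i"] that by (intro measurable_sets_borel[OF borel_measurable_uminus]) auto
  qed
  also have "{\<omega> \<in> \<Omega>\<^sub>0. \<forall>i<k. \<omega> (- \<tau>' (Suc i)) - \<omega> (- \<tau>' i) \<in> A' i} =
      {\<omega> \<in> \<Omega>\<^sub>0. \<forall>i<k. \<omega> (\<tau> (Suc i)) - \<omega> (\<tau> i) \<in> A i}"
  proof -
    have "(\<forall>i<k. \<omega> (- \<tau>' (Suc i)) - \<omega> (- \<tau>' i) \<in> A' i) \<longleftrightarrow>
        (\<forall>i<k. \<omega> (\<tau> (Suc (k - Suc i))) - \<omega> (\<tau> (k - Suc i)) \<in> A (k - Suc i))" for \<omega> :: "real \<Rightarrow> real"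
      by (intro all_cong) (simp add: \<tau>'_def A'_def Suc_diff_Suc)
    moreover have "(\<forall>i<k. \<omega> (\<tau> (Suc (k - Suc i))) - \<omega> (\<tau> (k - Suc i)) \<in> A (k - Suc i)) \<longleftrightarrow>
        (\<forall>i<k. \<omega> (\<tau> (Suc i)) - \<omega> (\<tau> i) \<in> A i)" for \<omega> :: "real \<Rightarrow> real"
    proof (intro iffI allI impI)
      fix i assume "\<forall>i<k. \<omega> (\<tau> (Suc (k - Suc i))) - \<omega> (\<tau> (k - Suc i)) \<in> A (k - Suc i)" "i < k"
      moreover have "k - Suc (k - Suc i) = i" "k - Suc i < k" using \<open>i < k\<close> by auto
      ultimately show "\<omega> (\<tau> (Suc i)) - \<omega> (\<tau> i) \<in> A i" by metis
    qed auto
    ultimately show ?thesis by simp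
  qed
  also have "(\<Prod>i<k. measure (normal_law (\<tau>' (Suc i) - \<tau>' i)) (A' i)) =
      (\<Prod>i<k. measure (normal_law (\<tau> (Suc (k - Suc i)) - \<tau> (k - Suc i))) (A (k - Suc i)))"
    unfolding A'_def using \<tau>(2) A inc
    by (intro prod.cong refl) (auto intro!: measure_normal_law_uminus)
  also have "\<dots> = (\<Prod>i<k. measure (normal_law (\<tau> (Suc i) - \<tau> i)) (A i))"
    by (rule prod.nat_diff_reindex)
  finally show ?thesis .
qed

text \<open>The grid is cut at index \<open>k\<close>, where it meets time 0: the later increments
  give an event \<open>E1\<close> of the forward half, the earlier ones an event \<open>E2\<close>
  of the backward half, and independence of the halves multiplies the two products.\<close>

lemma increments_through_zero:
  assumes \<tau>: "k \<le> n" "\<tau> k = 0" "\<And>i. i < n \<Longrightarrow> \<tau> i < \<tau> (Suc i)"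
    and A: "\<And>i. i < n \<Longrightarrow> A i \<in> sets borel"
  shows "prob {\<omega> \<in> \<Omega>\<^sub>0. \<forall>i<n. \<omega> (\<tau> (Suc i)) - \<omega> (\<tau> i) \<in> A i} =
    (\<Prod>i<n. measure (normal_law (\<tau> (Suc i) - \<tau> i)) (A i))"
proof -
  let ?M = "\<Pi>\<^sub>M t\<in>{0::real..}. (borel :: real measure)"
  let ?f = "\<lambda>i. measure (normal_law (\<tau> (Suc i) - \<tau> i)) (A i)"
  define E1 where "E1 = {f \<in> space ?M. \<forall>i\<in>{..<n - k}. f (\<tau> (k + Suc i)) - f (\<tau> (k + i)) \<in> A (k + i)}"
  define E2 where "E2 = {f \<in> space ?M. \<forall>i\<in>{..<k}. f (- \<tau> (Suc i)) - f (- \<tau> i) \<in> A i}"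
  have mono: "\<tau> i \<le> \<tau> j" if "i \<le> j" "j \<le> n" for i j
    using that
  proof (induction j)
    case (Suc j)
    then show ?case using \<tau>(3)[of j] by (cases "i = Suc j") auto
  qed simp
  have pos: "0 \<le> \<tau> i" if "k \<le> i" "i \<le> n" for i using mono[of k i] that \<tau>(2) by simp
  have neg: "\<tau> i \<le> 0" if "i \<le> k" for i using mono[of i k] that \<tau>(1,2) by simp
  have E1: "E1 \<in> sets ?M"
    unfolding E1_def
  proof (rule sets.sets_Collect_finite_All, goal_cases)
    case (1 i)
    then have "\<tau> (k + Suc i) \<in> {0..}" "\<tau> (k + i) \<in> {0..}" using pos by auto
    then have "(\<lambda>f. f (\<tau> (k + Suc i)) - f (\<tau> (k + i))) \<in> borel_measurable ?M"
      by (intro borel_measurable_diff measurable_component_singleton)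
    moreover have "A (k + i) \<in> sets borel" using A 1 by simp
    ultimately have "(\<lambda>f. f (\<tau> (k + Suc i)) - f (\<tau> (k + i))) -` A (k + i) \<inter> space ?M \<in> sets ?M" by (rule measurable_sets)
    then show ?case by (simp add: vimage_def Int_def conj_commute)
  qed auto
  have E2: "E2 \<in> sets ?M"
    unfolding E2_def
  proof (rule sets.sets_Collect_finite_All, goal_cases)
    case (1 i)
    then have "- \<tau> (Suc i) \<in> {0..}" "- \<tau> i \<in> {0..}" using neg by auto
    then have "(\<lambda>f. f (- \<tau> (Suc i)) - f (- \<tau> i)) \<in> borel_measurable ?M"
      by (intro borel_measurable_diff measurable_component_singleton)
    moreover have "A i \<in> sets borel" using A 1 \<tau>(1) by simp
    ultimately have "(\<lambda>f. f (- \<tau> (Suc i)) - f (- \<tau> i)) -` A i \<inter> space ?M \<in> sets ?M" by (rule measurable_sets)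
    then show ?case by (simp add: vimage_def Int_def conj_commute)
  qed auto
  let ?X = "\<lambda>\<omega>. \<lambda>t\<in>{0..}. \<omega> t" and ?Y = "\<lambda>\<omega>. \<lambda>t\<in>{0..}. \<omega> (- t)"
  have XE: "?X -` E1 \<inter> space P =
      {\<omega> \<in> \<Omega>\<^sub>0. \<forall>i<n - k. \<omega> (\<tau> (k + Suc i)) - \<omega> (\<tau> (k + i)) \<in> A (k + i)}"
    unfolding E1_def using pos by (auto simp: space_PiM)
  have YE: "?Y -` E2 \<inter> space P = {\<omega> \<in> \<Omega>\<^sub>0. \<forall>i<k. \<omega> (\<tau> (Suc i)) - \<omega> (\<tau> i) \<in> A i}"
    unfolding E2_def using neg by (auto simp: space_PiM)
  have "{\<omega> \<in> \<Omega>\<^sub>0. \<forall>i<n. \<omega> (\<tau> (Suc i)) - \<omega> (\<tau> i) \<in> A i} =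
      (?X -` E1 \<inter> space P) \<inter> (?Y -` E2 \<inter> space P)"
    unfolding XE YE
  proof (intro set_eqI iffI)
    fix \<omega> assume \<omega>: "\<omega> \<in> {\<omega> \<in> \<Omega>\<^sub>0. \<forall>i<n - k. \<omega> (\<tau> (k + Suc i)) - \<omega> (\<tau> (k + i)) \<in> A (k + i)} \<inter>
       {\<omega> \<in> \<Omega>\<^sub>0. \<forall>i<k. \<omega> (\<tau> (Suc i)) - \<omega> (\<tau> i) \<in> A i}"
    have "\<omega> (\<tau> (Suc i)) - \<omega> (\<tau> i) \<in> A i" if "i < n" for i
    proof (cases "i < k")
      case False
      then have "i - k < n - k" "i = k + (i - k)" using that by auto
      then show ?thesis using \<omega> by (metis (mono_tags, lifting) IntD1 add_Suc_right mem_Collect_eq)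
    qed (use \<omega> in auto)
    then show "\<omega> \<in> {\<omega> \<in> \<Omega>\<^sub>0. \<forall>i<n. \<omega> (\<tau> (Suc i)) - \<omega> (\<tau> i) \<in> A i}" using \<omega> by auto
  qed (use \<tau>(1) in auto)
  also have "prob ((?X -` E1 \<inter> space P) \<inter> (?Y -` E2 \<inter> space P)) =
      prob (?X -` E1 \<inter> space P) * prob (?Y -` E2 \<inter> space P)"
    using indep_varD[OF halves_indep E1 E2] by (simp add: Times_Int_distrib1 vimage_def Int_def conj_ac)
  also have "prob (?X -` E1 \<inter> space P) = (\<Prod>i<n - k. ?f (k + i))"
    unfolding XE
    using standard_brownian_motion_increments[OF bm, of "\<lambda>i. \<tau> (k + i)" "n - k" "\<lambda>i. A (k + i)"] \<tau> A
    by simp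
  also have "\<dots> = prod ?f {k..<n}"
    using prod.atLeastLessThan_shift_0[of ?f k n] by (simp add: atLeast0LessThan add.commute)
  also have "prob (?Y -` E2 \<inter> space P) = (\<Prod>i<k. ?f i)"
    unfolding YE using \<tau> A by (intro negative_increments) auto
  also have "prod ?f {k..<n} * prod ?f {..<k} = prod ?f {..<n}"
    using prod.atLeastLessThan_concat[of 0 k n ?f] \<tau>(1) by (simp add: atLeast0LessThan mult.commute)
  finally show ?thesis .
qed

text \<open>Both the grid \<open>\<tau>\<close> and its translate by \<open>u\<close> contain the time \<open>0\<close>, where the two independent
  halves of the path meet.\<close>

lemma increments_law_shift:
  assumes \<tau>: "\<And>i. i < n \<Longrightarrow> \<tau> i < \<tau> (Suc i)" and k: "k \<le> n" "\<tau> k = 0" and l: "l \<le> n" "\<tau> l = - u"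
  shows "distr P (PiM {..<n} (\<lambda>_. borel)) (\<lambda>\<omega>. \<lambda>i\<in>{..<n}. \<omega> (\<tau> (Suc i)) - \<omega> (\<tau> i)) =
    distr P (PiM {..<n} (\<lambda>_. borel)) (\<lambda>\<omega>. \<lambda>i\<in>{..<n}. \<omega> (u + \<tau> (Suc i)) - \<omega> (u + \<tau> i))"
    (is "distr P ?M ?D = distr P ?M ?E")
proof (rule measure_eqI_PiM_finite[where A = "\<lambda>_. Pi\<^sub>E {..<n} (\<lambda>_. UNIV)"])
  have DE: "?D \<in> measurable P ?M" "?E \<in> measurable P ?M"
    by (intro measurable_restrict borel_measurable_diff coordinate_measurable)+
  show "emeasure (distr P ?M ?D) (Pi\<^sub>E {..<n} A) = emeasure (distr P ?M ?E) (Pi\<^sub>E {..<n} A)"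
    if A: "\<And>i. i \<in> {..<n} \<Longrightarrow> A i \<in> sets borel" for A
  proof -
    have R: "Pi\<^sub>E {..<n} A \<in> sets ?M" using A by (intro sets_PiM_I_finite) auto
    have restr: "restrict h {..<n} \<in> Pi\<^sub>E {..<n} A \<longleftrightarrow> (\<forall>i<n. h i \<in> A i)" for h
      by (simp add: PiE_iff Ball_def)
    have "?D -` Pi\<^sub>E {..<n} A \<inter> space P = {\<omega> \<in> \<Omega>\<^sub>0. \<forall>i<n. \<omega> (\<tau> (Suc i)) - \<omega> (\<tau> i) \<in> A i}"
      "?E -` Pi\<^sub>E {..<n} A \<inter> space P = {\<omega> \<in> \<Omega>\<^sub>0. \<forall>i<n. \<omega> (u + \<tau> (Suc i)) - \<omega> (u + \<tau> i) \<in> A i}"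
      unfolding vimage_def restr space_P by blast+
    moreover have "prob {\<omega> \<in> \<Omega>\<^sub>0. \<forall>i<n. \<omega> (\<tau> (Suc i)) - \<omega> (\<tau> i) \<in> A i} =
        prob {\<omega> \<in> \<Omega>\<^sub>0. \<forall>i<n. \<omega> (u + \<tau> (Suc i)) - \<omega> (u + \<tau> i) \<in> A i}"
    proof -
      have "prob {\<omega> \<in> \<Omega>\<^sub>0. \<forall>i<n. \<omega> (u + \<tau> (Suc i)) - \<omega> (u + \<tau> i) \<in> A i} =
          (\<Prod>i<n. measure (normal_law (u + \<tau> (Suc i) - (u + \<tau> i))) (A i))"
        by (rule increments_through_zero) (use l \<tau> A in auto)
      also have "\<dots> = (\<Prod>i<n. measure (normal_law (\<tau> (Suc i) - \<tau> i)) (A i))"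
        by (simp only: add_diff_cancel_left)
      also have "\<dots> = prob {\<omega> \<in> \<Omega>\<^sub>0. \<forall>i<n. \<omega> (\<tau> (Suc i)) - \<omega> (\<tau> i) \<in> A i}"
        by (rule increments_through_zero[symmetric]) (use k \<tau> A in auto)
      finally show ?thesis ..
    qed
    ultimately show ?thesis
      unfolding emeasure_distr[OF DE(1) R] emeasure_distr[OF DE(2) R] by (simp only: emeasure_eq_measure)
  qed
  show "range (\<lambda>_::nat. Pi\<^sub>E {..<n} (\<lambda>_. UNIV :: real set)) \<subseteq> prod_algebra {..<n} (\<lambda>_. borel)"
    by (auto intro!: prod_algebraI_finite)
  show "emeasure (distr P ?M ?D) (Pi\<^sub>E {..<n} (\<lambda>_. UNIV)) \<noteq> \<infinity>"
    using finite_measure.emeasure_finite[OF finite_measure_distr[OF DE(1)]]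
    by (simp only: infinity_ennreal_def not_False_eq_True)
  show "(\<Union>i::nat. Pi\<^sub>E {..<n} (\<lambda>_. UNIV :: real set)) = space ?M"
    by (simp add: space_PiM)
  show "finite {..<n}" by simp
  show "sets (distr P ?M ?D) = sets ?M" by (rule sets_distr)
  show "sets (distr P ?M ?E) = sets ?M" by (rule sets_distr)
qed

section \<open>Invariance of the law under the Levy shift\<close>

lemma levy_shift_path_space: "\<omega> \<in> \<Omega>\<^sub>0 \<Longrightarrow> levy_shift u \<omega> \<in> \<Omega>\<^sub>0"
  unfolding levy_shift_def path_space_def
  by (auto intro!: continuous_intros intro: continuous_on_compose2[of UNIV])

text \<open>On an ordered grid through 0, the same function \<open>S\<close> of the increments
  yields the values of the path and of its shift, since both vanish at 0. Equal laws of increments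
  thus give equal laws of values.\<close>

lemma finite_dimensional_shift:
  assumes J: "finite J" and A: "\<And>j. j \<in> J \<Longrightarrow> A j \<in> sets borel"
  shows "prob {\<omega> \<in> \<Omega>\<^sub>0. \<forall>j\<in>J. \<omega> j \<in> A j} = prob {\<omega> \<in> \<Omega>\<^sub>0. \<forall>j\<in>J. levy_shift u \<omega> j \<in> A j}"
proof -
  define xs where "xs = sorted_list_of_set (insert 0 (insert (- u) J))"
  have xs: "set xs = insert 0 (insert (- u) J)" "sorted xs" "distinct xs" "xs \<noteq> []"
    using J sorted_list_of_set_nonempty unfolding xs_def
    by (simp_all del: sorted_list_of_set_insert_remove)
  define n where "n = length xs - 1"
  have n: "length xs = Suc n" using xs(4) by (cases xs) (auto simp: n_def)
  define \<tau> where "\<tau> i = xs ! i" for i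
  have \<tau>: "\<tau> i < \<tau> (Suc i)" if "i < n" for i
    using xs(2,3) n that unfolding \<tau>_def
    by (metis Suc_n_not_le_n less_Suc_eq nth_eq_iff_index_eq order_less_le sorted_nth_mono Suc_less_eq le_SucI order_refl)
  have ex: "\<exists>i\<le>n. \<tau> i = x" if "x \<in> set xs" for x
    using that n unfolding \<tau>_def in_set_conv_nth by (metis less_Suc_eq_le)
  obtain k l where k: "k \<le> n" "\<tau> k = 0" and l: "l \<le> n" "\<tau> l = - u" using ex xs(1) by (metis insertCI)
  obtain idx where idx: "\<And>j. j \<in> J \<Longrightarrow> idx j \<le> n \<and> \<tau> (idx j) = j" using ex xs(1) by (metis insertCI)
  let ?M = "PiM {..<n} (\<lambda>_. borel :: real measure)"
  let ?D = "\<lambda>\<omega> :: real \<Rightarrow> real. \<lambda>i\<in>{..<n}. \<omega> (\<tau> (Suc i)) - \<omega> (\<tau> i)"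
  let ?E = "\<lambda>\<omega> :: real \<Rightarrow> real. \<lambda>i\<in>{..<n}. \<omega> (u + \<tau> (Suc i)) - \<omega> (u + \<tau> i)"
  have DE: "?D \<in> measurable P ?M" "?E \<in> measurable P ?M"
    by (intro measurable_restrict borel_measurable_diff coordinate_measurable)+
  \<comment> \<open>The increments summed from time \<open>\<tau> k = 0\<close> to time
    \<open>\<tau> i\<close>; the difference of partial sums also covers \<open>i < k\<close>, with
    the right sign.\<close>
  define S where "S f i = (\<Sum>m<i. f m) - (\<Sum>m<k. f m)" for f :: "nat \<Rightarrow> real" and i
  define B where "B = {f \<in> space ?M. \<forall>j\<in>J. S f (idx j) \<in> A j}"
  have "B \<in> sets ?M"
    unfolding B_def
  proof (rule sets.sets_Collect_finite_All, goal_cases)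
    case (1 j)
    have "(\<lambda>f. S f (idx j)) \<in> borel_measurable ?M"
      unfolding S_def using idx[OF 1] k(1)
      by (intro borel_measurable_diff borel_measurable_sum measurable_component_singleton) auto
    from measurable_sets[OF this A[OF 1]] show ?case
      by (simp add: vimage_def Int_def conj_commute)
  qed (use J in auto)
  have SD: "S (?D \<omega>) i = \<omega> (\<tau> i)" if "i \<le> n" "\<omega> \<in> \<Omega>\<^sub>0" for \<omega> i
  proof -
    have "(\<Sum>m<i. ?D \<omega> m) = \<omega> (\<tau> i) - \<omega> (\<tau> 0)" if "i \<le> n" for i
      using that by (subst sum_lessThan_telescope[symmetric]) (auto intro!: sum.cong)
    from this[OF that(1)] this[OF k(1)] k(2) that(2) show ?thesis
      unfolding S_def by (simp add: path_space_def)
  qed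
  have SE: "S (?E \<omega>) i = levy_shift u \<omega> (\<tau> i)" if "i \<le> n" for \<omega> i
  proof -
    have "(\<Sum>m<i. ?E \<omega> m) = \<omega> (u + \<tau> i) - \<omega> (u + \<tau> 0)" if "i \<le> n" for i
      using that by (subst sum_lessThan_telescope[symmetric, of "\<lambda>i. \<omega> (u + \<tau> i)"]) (auto intro!: sum.cong)
    from this[OF that] this[OF k(1)] k(2) show ?thesis
      unfolding S_def by (simp add: levy_shift_def)
  qed
  have "?D -` B \<inter> space P = {\<omega> \<in> \<Omega>\<^sub>0. \<forall>j\<in>J. \<omega> j \<in> A j}"
    unfolding B_def using SD idx by (auto simp: space_PiM)
  moreover have "?E -` B \<inter> space P = {\<omega> \<in> \<Omega>\<^sub>0. \<forall>j\<in>J. levy_shift u \<omega> j \<in> A j}"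
    unfolding B_def using SE idx by (auto simp: space_PiM)
  moreover have "measure (distr P ?M ?D) B = measure (distr P ?M ?E) B"
    using increments_law_shift[OF \<tau> k l] by simp
  ultimately show ?thesis
    using \<open>B \<in> sets ?M\<close> DE by (simp add: measure_distr)
qed

text \<open>In the product space over all times, the path and its shift have the same
  finite-dimensional laws, hence the same law. Borel sets of paths are traces of product sets and
  the shift preserves \<open>\<Omega>\<^sub>0\<close>, so measurability and invariance are read off
  from there.\<close>

lemma levy_shift_law: "distr P P (levy_shift u) = P" and levy_shift_measurable: "levy_shift u \<in> measurable P P"
proof -
  let ?M = "PiM UNIV (\<lambda>_::real. borel :: real measure)"
  have coord: "(\<lambda>\<omega>. \<omega>) \<in> measurable P ?M" "levy_shift u \<in> measurable P ?M"
    unfolding levy_shift_def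
    by (intro measurable_PiM_single'; simp add: PiE_UNIV_domain)+
  have law: "distr P ?M (\<lambda>\<omega>. \<omega>) = distr P ?M (levy_shift u)"
  proof (rule measure_eqI_PiM_infinite)
    fix J and A :: "real \<Rightarrow> real set"
    assume J: "finite J" and A: "\<And>i. i \<in> J \<Longrightarrow> A i \<in> sets borel"
    let ?B = "prod_emb UNIV (\<lambda>_. borel) J (Pi\<^sub>E J A)"
    have B: "?B \<in> sets ?M" using J A by (intro sets_PiM_I) auto
    have "?B = {f. \<forall>j\<in>J. f j \<in> A j}"
      by (auto simp: prod_emb_def space_PiM PiE_iff)
    then have "emeasure P ((\<lambda>\<omega>. \<omega>) -` ?B \<inter> space P) = emeasure P (levy_shift u -` ?B \<inter> space P)"
      using finite_dimensional_shift[OF J A] by (simp add: emeasure_eq_measure Int_def vimage_def conj_commute)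
    then show "emeasure (distr P ?M (\<lambda>\<omega>. \<omega>)) ?B = emeasure (distr P ?M (levy_shift u)) ?B"
      using B coord by (simp add: emeasure_distr)
  qed (use coord in \<open>auto intro!: finite_measure_distr\<close>)
  have cyl: "\<exists>B\<in>sets ?M. A = B \<inter> \<Omega>\<^sub>0" if "A \<in> sets P" for A
    using that sets_path_borel_subset unfolding sets_P sets_restrict_space by auto
  have pre: "levy_shift u -` A \<inter> space P = levy_shift u -` B \<inter> space P" if "A = B \<inter> \<Omega>\<^sub>0" for A B
    using that levy_shift_path_space by auto
  show meas: "levy_shift u \<in> measurable P P"
  proof (rule measurableI)
    fix A assume "A \<in> sets P"
    then obtain B where "B \<in> sets ?M" "A = B \<inter> \<Omega>\<^sub>0" using cyl by blast
    then show "levy_shift u -` A \<inter> space P \<in> sets P" using pre measurable_sets[OF coord(2)] by simp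
  qed (simp add: levy_shift_path_space)
  show "distr P P (levy_shift u) = P"
  proof (rule measure_eqI)
    fix A assume A: "A \<in> sets (distr P P (levy_shift u))"
    then obtain B where B: "B \<in> sets ?M" "A = B \<inter> \<Omega>\<^sub>0" using cyl by auto
    have "emeasure P (levy_shift u -` B \<inter> space P) = emeasure P ((\<lambda>\<omega>. \<omega>) -` B \<inter> space P)"
      using arg_cong[OF law, of "\<lambda>N. emeasure N B"] coord B(1) by (simp add: emeasure_distr)
    then show "emeasure (distr P P (levy_shift u)) A = emeasure P A"
      using A pre[OF B(2)] meas B(2) by (simp add: emeasure_distr)
  qed simp
qed

end

section \<open>Last points before a given time\<close>

lemma levy_shift_levy_shift: "levy_shift u (levy_shift v \<omega>) = levy_shift (v + u) \<omega>"
  unfolding levy_shift_def by (simp add: algebra_simps)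

lemma levy_shift_0: "\<omega> \<in> \<Omega>\<^sub>0 \<Longrightarrow> levy_shift 0 \<omega> = \<omega>"
  unfolding levy_shift_def path_space_def by auto

text \<open>A generating interval that contains \<open>x\<close> contains \<open>{a<..x}\<close> for
  its left end \<open>a\<close>, and this survives finite intersections and unions.\<close>

lemma generate_upper_limit_topology_on:
  assumes "generate_topology_on {{a<..b} | a b :: real. True} U" "x \<in> U"
  shows "\<exists>a<x. {a<..x} \<subseteq> U"
  using assms
proof (induction arbitrary: x)
  case (Int U V)
  then obtain a b where "a < x" "{a<..x} \<subseteq> U" "b < x" "{b<..x} \<subseteq> V" by (meson IntD1 IntD2)
  then show ?case by (intro exI[of _ "max a b"]) auto
next
  case (UN K)
  then show ?case by (meson Sup_upper UnionE order_trans)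
next
  case (Basis s)
  then show ?case by fastforce
qed auto

text \<open>The almost sure properties (a), (b), (d) for the pair of times \<open>p < q\<close>, transported by the shift
  to the time origin \<open>p\<close>.\<close>

definition regular_between ::
    "((real \<Rightarrow> real) \<times> real) set \<Rightarrow> (real \<Rightarrow> real) \<Rightarrow> real \<Rightarrow> real \<Rightarrow> bool" where
  "regular_between \<Gamma> \<omega> p q \<longleftrightarrow>
     0 \<in> \<Gamma> `` {levy_shift p \<omega>} \<and> closedin upper_limit_topology (\<Gamma> `` {levy_shift p \<omega>}) \<and>
     (\<forall>s. s \<in> \<Gamma> `` {levy_shift p \<omega>} \<inter> {q - p..} \<longrightarrow>
        \<Gamma> `` {levy_shift p \<omega>} \<inter> {s..} = (+) (q - p) ` (\<Gamma> `` {levy_shift q \<omega>}) \<inter> {s..})"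

text \<open>A supremum is approached from the left, hence by points in every
  \<open>{c<..?c}\<close>; were it outside \<open>A\<close>, the open complement would contain one
  of these intervals.\<close>

lemma closedin_upper_limit_atLeastAtMost:
  assumes A: "closedin upper_limit_topology A"
    and ne: "A \<inter> {a..b} \<noteq> {}"
  shows "Sup (A \<inter> {a..b}) \<in> A \<inter> {a..b}"
proof -
  let ?c = "Sup (A \<inter> {a..b})"
  have bdd: "bdd_above (A \<inter> {a..b})" by (rule bdd_aboveI[of _ b]) auto
  obtain y where y: "y \<in> A \<inter> {a..b}" using ne by blast
  have "a \<le> ?c" using cSup_upper[OF y bdd] y by simp
  moreover have "?c \<le> b" using ne by (intro cSup_least) auto
  moreover have "?c \<in> A"
  proof (rule ccontr)
    assume "?c \<notin> A"
    have "?c \<in> {?c - 1<..?c}" by simp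
    then have "?c \<in> topspace upper_limit_topology"
      unfolding upper_limit_topology_def topology_generated_by_topspace by blast
    moreover have "openin upper_limit_topology (topspace upper_limit_topology - A)"
      using A by (simp add: closedin_def)
    ultimately obtain c where c: "c < ?c" "{c<..?c} \<subseteq> topspace upper_limit_topology - A"
      using generate_upper_limit_topology_on[of "topspace upper_limit_topology - A" ?c] \<open>?c \<notin> A\<close>
      by (auto simp: upper_limit_topology_def openin_topology_generated_by_iff)
    then obtain y where "y \<in> A \<inter> {a..b}" "c < y" using less_cSup_iff[OF ne bdd] by blast
    then show False using c(2) cSup_upper[OF _ bdd, of y] by auto
  qed
  ultimately show ?thesis by simp
qed

lemma last_point_localize:
  assumes reg: "regular_between \<Gamma> \<omega> p p'" and x: "x = last_point \<Gamma> p q \<omega>"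
    and pq: "p < p'" "p' < x" "x < q'" "q' \<le> q"
  shows "last_point \<Gamma> p' q' \<omega> = x"
proof -
  let ?G = "\<lambda>r. \<Gamma> `` {levy_shift r \<omega>}"
  let ?A = "?G p \<inter> {0..q - p}"
  have "0 \<in> ?A" using reg pq unfolding regular_between_def by auto
  then have ne: "?A \<noteq> {}" by blast
  then have xS: "x - p = Sup ?A" unfolding x last_point_def by (simp add: Let_def)
  then have xA: "x - p \<in> ?A"
    using closedin_upper_limit_atLeastAtMost[OF _ ne] reg unfolding regular_between_def by auto
  have max: "y \<le> x - p" if "y \<in> ?A" for y
    unfolding xS by (rule cSup_upper[OF that]) (rule bdd_aboveI[of _ "q - p"], auto)
  have shift: "?G p \<inter> {x - p..} = (+) (p' - p) ` ?G p' \<inter> {x - p..}"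
    using reg xA pq unfolding regular_between_def by simp
  then have "x - p \<in> (+) (p' - p) ` ?G p'" using xA by auto
  then have "x - p' \<in> ?G p'" by (auto simp: algebra_simps)
  then have xA': "x - p' \<in> ?G p' \<inter> {0..q' - p'}" using pq by auto
  \<comment> \<open>A later point seen from \<open>p'\<close> would be visible from \<open>p\<close>
    too, within \<open>q - p\<close> because \<open>q' \<le> q\<close>, against the maximality of
    \<open>x - p\<close>.\<close>
  have "y \<le> x - p'" if y: "y \<in> ?G p' \<inter> {0..q' - p'}" for y
  proof (rule ccontr)
    assume "\<not> y \<le> x - p'"
    then have "(p' - p) + y \<in> (+) (p' - p) ` ?G p' \<inter> {x - p..}" using y by auto
    then have "(p' - p) + y \<in> ?G p" "0 \<le> y" "y \<le> q' - p'" unfolding shift[symmetric] using y by auto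
    then have "(p' - p) + y \<in> ?A" using pq by simp
    from max[OF this] \<open>\<not> y \<le> x - p'\<close> show False by simp
  qed
  then have "Sup (?G p' \<inter> {0..q' - p'}) = x - p'" using xA' by (intro cSup_eq_maximum)
  then show ?thesis using xA' unfolding last_point_def Let_def by auto
qed

lemma last_point_levy_shift: "u + last_point \<Gamma> p q (levy_shift u \<omega>) = last_point \<Gamma> (u + p) (u + q) \<omega>"
  unfolding last_point_def levy_shift_levy_shift by (simp add: Let_def)

definition last_points_of ::
    "((real \<Rightarrow> real) \<times> real) set \<Rightarrow> real set \<Rightarrow> (real \<Rightarrow> real) \<Rightarrow> real set" where
  "last_points_of \<Gamma> D \<omega> = {last_point \<Gamma> p q \<omega> | p q.
     p \<in> D \<and> q \<in> D \<and> p < q \<and> last_point \<Gamma> p q \<omega> \<in> {p<..<q}}"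

lemma last_points_of_Rats: "last_points_of \<Gamma> \<rat> \<omega> = last_points \<Gamma> \<omega>"
  unfolding last_points_of_def last_points_def ..

lemma last_points_of_mono_dense:
  assumes reg: "\<And>p q. p \<in> D \<Longrightarrow> q \<in> E \<Longrightarrow> p < q \<Longrightarrow> regular_between \<Gamma> \<omega> p q"
    and dense: "\<And>a b. a < b \<Longrightarrow> \<exists>r\<in>E. a < r \<and> r < b"
  shows "last_points_of \<Gamma> D \<omega> \<subseteq> last_points_of \<Gamma> E \<omega>"
proof
  fix x assume "x \<in> last_points_of \<Gamma> D \<omega>"
  then obtain p q where pq: "p \<in> D" "q \<in> D" "p < x" "x < q" "x = last_point \<Gamma> p q \<omega>"
    unfolding last_points_of_def by auto
  obtain p' q' where p': "p' \<in> E" "p < p'" "p' < x" and q': "q' \<in> E" "x < q'" "q' < q"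
    using dense[OF pq(3)] dense[OF pq(4)] by blast
  have "last_point \<Gamma> p' q' \<omega> = x"
    using last_point_localize[OF reg[OF pq(1) p'(1,2)] pq(5) p'(2,3) q'(2)] q'(3) by simp
  then show "x \<in> last_points_of \<Gamma> E \<omega>"
    unfolding last_points_of_def using p' q' by force
qed

lemma levy_shift_last_points:
  "(+) u ` last_points \<Gamma> (levy_shift u \<omega>) = last_points_of \<Gamma> ((+) u ` \<rat>) \<omega>"
proof -
  have "(+) u ` last_points \<Gamma> (levy_shift u \<omega>) =
      {last_point \<Gamma> (u + p) (u + q) \<omega> | p q. p \<in> \<rat> \<and> q \<in> \<rat> \<and> u + p < u + q \<and>
        last_point \<Gamma> (u + p) (u + q) \<omega> \<in> {u + p<..<u + q}}"
    unfolding last_points_def last_point_levy_shift[symmetric] by auto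
  also have "\<dots> = last_points_of \<Gamma> ((+) u ` \<rat>) \<omega>"
    unfolding last_points_of_def by blast
  finally show ?thesis .
qed

section \<open>Fields of increments and measurability of last points\<close>

lemma space_increments_field: "space (increments_field W s t) = \<Omega>\<^sub>0" if "space W = \<Omega>\<^sub>0"
  unfolding increments_field_def using that
  by (intro space_measure_of) (auto dest: sets.sets_into_space)

lemma increments_field_mono:
  assumes W: "space W = \<Omega>\<^sub>0" and st: "s \<le> s'" "t' \<le> t"
  shows "sets (increments_field W s' t') \<subseteq> sets (increments_field W s t)"
proof -
  have *: "{(\<lambda>\<omega>. \<omega> b - \<omega> a) -` A \<inter> \<Omega>\<^sub>0 | a b A. s \<le> ereal a \<and> a \<le> b \<and> ereal b \<le> t \<and> A \<in> sets borel} \<union>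
      {N \<in> sets W. measure W N = 0 \<or> measure W N = 1} \<subseteq> Pow \<Omega>\<^sub>0" for s t
    using W by (auto dest: sets.sets_into_space)
  show ?thesis
    unfolding increments_field_def sets_measure_of[OF *]
  proof (intro sigma_sets_mono' Un_mono order_refl subsetI)
    fix Y assume "Y \<in> {(\<lambda>\<omega>. \<omega> b - \<omega> a) -` A \<inter> \<Omega>\<^sub>0 | a b A. s' \<le> ereal a \<and> a \<le> b \<and> ereal b \<le> t' \<and> A \<in> sets borel}"
    then obtain a b A where "Y = (\<lambda>\<omega>. \<omega> b - \<omega> a) -` A \<inter> \<Omega>\<^sub>0" "s' \<le> ereal a" "a \<le> b" "ereal b \<le> t'" "A \<in> sets borel"
      by blast
    moreover from this have "s \<le> ereal a" "ereal b \<le> t" using st order_trans by blast+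
    ultimately show "Y \<in> {(\<lambda>\<omega>. \<omega> b - \<omega> a) -` A \<inter> \<Omega>\<^sub>0 | a b A. s \<le> ereal a \<and> a \<le> b \<and> ereal b \<le> t \<and> A \<in> sets borel}"
      by blast
  qed
qed

lemma increment_measurable_increments_field:
  assumes W: "space W = \<Omega>\<^sub>0" and ab: "s \<le> ereal a" "a \<le> b" "ereal b \<le> t"
  shows "(\<lambda>\<omega>. \<omega> b - \<omega> a) \<in> borel_measurable (increments_field W s t)"
proof (rule measurableI)
  fix A :: "real set" assume A: "A \<in> sets borel"
  have "(\<lambda>\<omega>. \<omega> b - \<omega> a) -` A \<inter> \<Omega>\<^sub>0 \<in> sets (increments_field W s t)"
    unfolding increments_field_def using W A ab
    by (intro in_measure_of) (auto dest: sets.sets_into_space)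
  then show "(\<lambda>\<omega>. \<omega> b - \<omega> a) -` A \<inter> space (increments_field W s t) \<in> sets (increments_field W s t)"
    by (simp add: space_increments_field[OF W])
qed simp

lemma trivial_sets_increments_field:
  assumes W: "space W = \<Omega>\<^sub>0" and N: "N \<in> sets W" "measure W N = 0 \<or> measure W N = 1"
  shows "N \<in> sets (increments_field W s t)"
  unfolding increments_field_def using W N
  by (intro in_measure_of) (auto dest: sets.sets_into_space)

lemma measurable_increments_fieldI:
  assumes W: "space W = \<Omega>\<^sub>0" and f: "f \<in> space M \<rightarrow> \<Omega>\<^sub>0"
    and inc: "\<And>a b. s \<le> ereal a \<Longrightarrow> a \<le> b \<Longrightarrow> ereal b \<le> t \<Longrightarrow> (\<lambda>x. f x b - f x a) \<in> borel_measurable M"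
    and triv: "\<And>N. N \<in> sets W \<Longrightarrow> measure W N = 0 \<or> measure W N = 1 \<Longrightarrow> f -` N \<inter> space M \<in> sets M"
  shows "f \<in> measurable M (increments_field W s t)"
  unfolding increments_field_def
proof (rule measurable_measure_of)
  show "{(\<lambda>\<omega>. \<omega> b - \<omega> a) -` A \<inter> \<Omega>\<^sub>0 | a b A. s \<le> ereal a \<and> a \<le> b \<and> ereal b \<le> t \<and> A \<in> sets borel} \<union>
      {N \<in> sets W. measure W N = 0 \<or> measure W N = 1} \<subseteq> Pow \<Omega>\<^sub>0"
    using W by (auto dest: sets.sets_into_space)
  fix Y assume "Y \<in> {(\<lambda>\<omega>. \<omega> b - \<omega> a) -` A \<inter> \<Omega>\<^sub>0 | a b A. s \<le> ereal a \<and> a \<le> b \<and> ereal b \<le> t \<and> A \<in> sets borel} \<union>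
      {N \<in> sets W. measure W N = 0 \<or> measure W N = 1}"
  then show "f -` Y \<inter> space M \<in> sets M"
  proof
    assume "Y \<in> {(\<lambda>\<omega>. \<omega> b - \<omega> a) -` A \<inter> \<Omega>\<^sub>0 | a b A. s \<le> ereal a \<and> a \<le> b \<and> ereal b \<le> t \<and> A \<in> sets borel}"
    then obtain a b A where Y: "Y = (\<lambda>\<omega>. \<omega> b - \<omega> a) -` A \<inter> \<Omega>\<^sub>0"
      and ab: "s \<le> ereal a" "a \<le> b" "ereal b \<le> t" "A \<in> sets borel" by blast
    have "f -` Y \<inter> space M = (\<lambda>x. f x b - f x a) -` A \<inter> space M"
      using f unfolding Y by auto
    also have "\<dots> \<in> sets M" using inc[OF ab(1-3)] ab(4) by (rule measurable_sets)
    finally show ?thesis .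
  qed (use triv in auto)
qed (rule f)

context two_sided_bm
begin

abbreviation \<W> where "\<W> \<equiv> completion P"

abbreviation \<F> where "\<F> s t \<equiv> increments_field \<W> s t"

lemma space_W: "space \<W> = \<Omega>\<^sub>0" by simp

text \<open>For the completion, preimages of null sets have to be measurable; they are null because
  the shift preserves \<open>P\<close>.\<close>

lemma levy_shift_measurable_W: "levy_shift u \<in> measurable \<W> \<W>"
  and distr_levy_shift_W: "distr \<W> \<W> (levy_shift u) = \<W>"
proof -
  have m: "levy_shift u \<in> measurable \<W> P" by (intro measurable_completion levy_shift_measurable)
  have d: "distr \<W> P (levy_shift u) = P"
    using distr_completion[OF levy_shift_measurable] levy_shift_law by simp
  show "levy_shift u \<in> measurable \<W> \<W>"
    by (rule completion.measurable_completion2[OF m]) (simp add: d)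
  show "distr \<W> \<W> (levy_shift u) = \<W>"
    using completion.completion_distr_eq[OF m] d by simp
qed

lemma AE_levy_shift: "AE \<omega> in \<W>. Q \<omega> \<Longrightarrow> AE \<omega> in \<W>. Q (levy_shift u \<omega>)"
  by (rule AE_distrD[OF levy_shift_measurable_W, unfolded distr_levy_shift_W])

lemma subalgebra_increments: "subalgebra \<W> (\<F> s t)"
proof -
  have "(\<lambda>\<omega>. \<omega>) \<in> measurable \<W> (\<F> s t)"
  proof (rule measurable_increments_fieldI)
    fix N assume "N \<in> sets \<W>"
    then show "(\<lambda>\<omega>. \<omega>) -` N \<inter> space \<W> \<in> sets \<W>" by (simp only: vimage_ident sets.Int_space_eq2)
  qed (auto intro!: measurable_completion borel_measurable_diff)
  from measurable_sets[OF this] have "A \<inter> \<Omega>\<^sub>0 \<in> sets \<W>" if "A \<in> sets (\<F> s t)" for A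
    using that by (simp only: vimage_ident space_W)
  moreover have "A \<inter> \<Omega>\<^sub>0 = A" if "A \<in> sets (\<F> s t)" for A
    using sets.sets_into_space[OF that] by (auto simp: space_increments_field)
  ultimately have "A \<in> sets \<W>" if "A \<in> sets (\<F> s t)" for A
    using that by metis
  then show ?thesis unfolding subalgebra_def by (auto simp: space_increments_field)
qed

text \<open>The increment of the shifted path over \<open>a\<close>, \<open>b\<close> is that of the
  path over \<open>p + a\<close>, \<open>p + b\<close>, and invariance preserves events of
  probability 0 or 1.\<close>

lemma levy_shift_measurable_increments:
  "levy_shift p \<in> measurable (\<F> (ereal p) (ereal q)) (\<F> 0 (ereal (q - p)))"
proof (rule measurable_increments_fieldI[OF space_W])
  show "levy_shift p \<in> space (\<F> (ereal p) (ereal q)) \<rightarrow> \<Omega>\<^sub>0"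
    by (auto simp: space_increments_field levy_shift_path_space)
  fix a b :: real assume "0 \<le> ereal a" "a \<le> b" "ereal b \<le> ereal (q - p)"
  then show "(\<lambda>\<omega>. levy_shift p \<omega> b - levy_shift p \<omega> a) \<in> borel_measurable (\<F> (ereal p) (ereal q))"
    unfolding levy_shift_def diff_diff_eq2 using increment_measurable_increments_field[OF space_W, of "ereal p" "p + a" "p + b" "ereal q"]
    by (simp add: algebra_simps)
next
  fix N assume N: "N \<in> sets \<W>" "measure \<W> N = 0 \<or> measure \<W> N = 1"
  have "measure \<W> (levy_shift p -` N \<inter> space \<W>) = measure \<W> N"
    using measure_distr[OF levy_shift_measurable_W N(1)] distr_levy_shift_W by simp
  then show "levy_shift p -` N \<inter> space (\<F> (ereal p) (ereal q)) \<in> sets (\<F> (ereal p) (ereal q))"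
    using N measurable_sets[OF levy_shift_measurable_W N(1), of p]
    by (simp add: space_increments_field) (intro trivial_sets_increments_field; simp)
qed

text \<open>The field contains all events of probability 0, and subsets of these are again such
  events. This keeps projections inside the field itself rather than in an enlargement.\<close>

lemma complete_measure_increments: "complete_measure (restr_to_subalg \<W> (\<F> s t))"
proof
  fix A B assume AB: "B \<subseteq> A" "A \<in> null_sets (restr_to_subalg \<W> (\<F> s t))"
  then have "A \<in> null_sets \<W>" using null_sets_restr_to_subalg[OF subalgebra_increments] by auto
  then have "B \<in> null_sets \<W>" by (rule completion.complete2[OF AB(1)])
  then have "B \<in> sets (\<F> s t)"
    by (intro trivial_sets_increments_field) (auto simp: measure_def)
  then show "B \<in> sets (restr_to_subalg \<W> (\<F> s t))"
    by (simp add: sets_restr_to_subalg[OF subalgebra_increments])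
qed

text \<open>For \<open>0 \<le> y\<close>, the value exceeds \<open>y\<close> exactly if
  \<open>\<Gamma>\<close> has a time in \<open>{y<..r}\<close> over the path: the event is the
  projection of a part of \<open>\<Gamma>\<close> that progressivity places in the product field
  over \<open>{0..r}\<close>.\<close>

lemma last_point_0_measurable:
  assumes prog: "progressive \<W> \<Gamma>" and r: "0 \<le> r"
  shows "last_point \<Gamma> 0 r \<in> borel_measurable (\<F> 0 (ereal r))"
proof (rule borel_measurableI_greater)
  fix y
  let ?F = "\<F> 0 (ereal r)"
  \<comment> \<open>\<open>?F\<close> is generated with the zero measure; \<open>?R\<close> has the
    same sets and carries the values of the Wiener measure.\<close>
  let ?R = "restr_to_subalg \<W> ?F"
  let ?B = "restrict_space borel {0..r}"
  interpret R: complete_measure ?R by (rule complete_measure_increments)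
  have sub: "subalgebra \<W> ?F" by (rule subalgebra_increments)
  have spF: "space ?F = \<Omega>\<^sub>0" by (rule space_increments_field[OF space_W])
  have lp: "last_point \<Gamma> 0 r \<omega> = (if \<Gamma> `` {\<omega>} \<inter> {0..r} = {} then 0 else Sup (\<Gamma> `` {\<omega>} \<inter> {0..r}))"
    if "\<omega> \<in> \<Omega>\<^sub>0" for \<omega>
    unfolding last_point_def by (simp add: levy_shift_0[OF that] Let_def)
  have bdd: "bdd_above (X \<inter> {0..r})" for X by (rule bdd_aboveI[of _ r]) auto
  show "{\<omega> \<in> space ?F. y < last_point \<Gamma> 0 r \<omega>} \<in> sets ?F"
  proof (cases "y < 0")
    case True
    have "y < last_point \<Gamma> 0 r \<omega>" if "\<omega> \<in> \<Omega>\<^sub>0" for \<omega>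
    proof (cases "\<Gamma> `` {\<omega>} \<inter> {0..r} = {}")
      case False
      then obtain z where "z \<in> \<Gamma> `` {\<omega>} \<inter> {0..r}" by blast
      then show ?thesis using cSup_upper[OF _ bdd, of z "\<Gamma> `` {\<omega>}"] lp[OF that] True by auto
    qed (use lp[OF that] True in simp)
    then have "{\<omega> \<in> space ?F. y < last_point \<Gamma> 0 r \<omega>} = space ?F" by (auto simp: spF)
    then show ?thesis by simp
  next
    case False
    have "{y<..} \<inter> {0..r} \<in> sets ?B" by (auto simp: sets_restrict_space)
    then have "space ?F \<times> ({y<..} \<inter> {0..r}) \<in> sets (?F \<Otimes>\<^sub>M ?B)" by (intro pair_measureI) auto
    moreover have "\<Gamma> \<inter> (\<Omega>\<^sub>0 \<times> {0..r}) \<in> sets (?F \<Otimes>\<^sub>M ?B)"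
      using prog r unfolding progressive_def by auto
    ultimately have "\<Gamma> \<inter> (\<Omega>\<^sub>0 \<times> {0..r}) \<inter> (space ?F \<times> ({y<..} \<inter> {0..r})) \<in> sets (?F \<Otimes>\<^sub>M ?B)"
      by (rule sets.Int[rotated])
    also have "\<Gamma> \<inter> (\<Omega>\<^sub>0 \<times> {0..r}) \<inter> (space ?F \<times> ({y<..} \<inter> {0..r})) = \<Gamma> \<inter> (\<Omega>\<^sub>0 \<times> ({y<..} \<inter> {0..r}))"
      by (auto simp: spF)
    also have "sets (?F \<Otimes>\<^sub>M ?B) = sets (?R \<Otimes>\<^sub>M ?B)"
      by (intro sets_pair_measure_cong) (simp_all add: sets_restr_to_subalg[OF sub])
    finally have "fst ` (\<Gamma> \<inter> (\<Omega>\<^sub>0 \<times> ({y<..} \<inter> {0..r}))) \<in> sets ?R"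
    proof (rule R.measurable_projection[rotated 2])
      have "space ?F \<in> sets ?F" by simp
      then have "emeasure ?R (space ?F) = emeasure \<W> (space ?F)" by (rule emeasure_restr_to_subalg[OF sub])
      then show "emeasure ?R (space ?R) \<noteq> \<infinity>"
        using prob_space.emeasure_space_1[OF prob_space_completion] by (simp add: space_restr_to_subalg spF)
    qed simp
    moreover have "{\<omega> \<in> space ?F. y < last_point \<Gamma> 0 r \<omega>} = fst ` (\<Gamma> \<inter> (\<Omega>\<^sub>0 \<times> ({y<..} \<inter> {0..r})))"
    proof (intro equalityI subsetI)
      fix \<omega> assume "\<omega> \<in> {\<omega> \<in> space ?F. y < last_point \<Gamma> 0 r \<omega>}"
      then have \<omega>: "\<omega> \<in> \<Omega>\<^sub>0" "y < last_point \<Gamma> 0 r \<omega>" by (auto simp: spF)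
      \<comment> \<open>The default value 0 cannot exceed a nonnegative \<open>y\<close>, which
        rules out an empty section.\<close>
      then have ne: "\<Gamma> `` {\<omega>} \<inter> {0..r} \<noteq> {}" and "y < Sup (\<Gamma> `` {\<omega>} \<inter> {0..r})"
        using lp[OF \<omega>(1)] False by (auto split: if_splits)
      then obtain z where "z \<in> \<Gamma> `` {\<omega>} \<inter> {0..r}" "y < z"
        using less_cSup_iff[OF ne bdd] by blast
      then show "\<omega> \<in> fst ` (\<Gamma> \<inter> (\<Omega>\<^sub>0 \<times> ({y<..} \<inter> {0..r})))" using \<omega> by force
    next
      fix \<omega> assume "\<omega> \<in> fst ` (\<Gamma> \<inter> (\<Omega>\<^sub>0 \<times> ({y<..} \<inter> {0..r})))"
      then obtain z where z: "\<omega> \<in> \<Omega>\<^sub>0" "z \<in> \<Gamma> `` {\<omega>} \<inter> {0..r}" "y < z" by auto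
      then have "y < Sup (\<Gamma> `` {\<omega>} \<inter> {0..r})" using cSup_upper[OF z(2) bdd] by simp
      then show "\<omega> \<in> {\<omega> \<in> space ?F. y < last_point \<Gamma> 0 r \<omega>}" using z lp[OF z(1)] by (auto simp: spF)
    qed
    ultimately show ?thesis by (simp add: sets_restr_to_subalg[OF sub])
  qed
qed

lemma last_point_measurable:
  assumes prog: "progressive \<W> \<Gamma>" and pq: "p < q" "s \<le> ereal p" "ereal q \<le> t"
  shows "last_point \<Gamma> p q \<in> borel_measurable (\<F> s t)"
proof -
  have "last_point \<Gamma> p q = (\<lambda>\<omega>. p + last_point \<Gamma> 0 (q - p) (levy_shift p \<omega>))"
    using last_point_levy_shift[of p \<Gamma> 0 "q - p"] by (intro ext) simp
  also have "\<dots> \<in> borel_measurable (\<F> (ereal p) (ereal q))"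
    using measurable_compose[OF levy_shift_measurable_increments last_point_0_measurable[OF prog]] pq(1)
    by (intro borel_measurable_add) auto
  finally show ?thesis
    using increments_field_mono[OF space_W pq(2,3)]
    by (auto simp: measurable_def space_increments_field)
qed

text \<open>Property (d) at \<open>u = q - p\<close> is transported along the shift by
  \<open>p\<close>, and the two shifts compose to the shift by \<open>q\<close>. Each pair has its
  own null set; countability of \<open>D\<close> collects them.\<close>

lemma AE_regular_between:
  assumes a: "AE \<omega> in \<W>. 0 \<in> \<Gamma> `` {\<omega>}"
    and b: "AE \<omega> in \<W>. closedin upper_limit_topology (\<Gamma> `` {\<omega>})"
    and d: "\<forall>u\<ge>0. AE \<omega> in \<W>. \<forall>s. s \<in> \<Gamma> `` {\<omega>} \<inter> {u..} \<longrightarrow>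
              \<Gamma> `` {\<omega>} \<inter> {s..} = (+) u ` (\<Gamma> `` {levy_shift u \<omega>}) \<inter> {s..}"
    and D: "countable D"
  shows "AE \<omega> in \<W>. \<forall>p\<in>D. \<forall>q\<in>D. p < q \<longrightarrow> regular_between \<Gamma> \<omega> p q"
proof -
  have "AE \<omega> in \<W>. p < q \<longrightarrow> regular_between \<Gamma> \<omega> p q" for p q
  proof (cases "p < q")
    case True
    then have "AE \<omega> in \<W>. \<forall>s. s \<in> \<Gamma> `` {\<omega>} \<inter> {q - p..} \<longrightarrow>
        \<Gamma> `` {\<omega>} \<inter> {s..} = (+) (q - p) ` (\<Gamma> `` {levy_shift (q - p) \<omega>}) \<inter> {s..}"
      using d by simp
    from AE_levy_shift[OF this, of p] AE_levy_shift[OF a, of p] AE_levy_shift[OF b, of p]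
    show ?thesis
      unfolding regular_between_def levy_shift_levy_shift by eventually_elim simp
  qed simp
  then show ?thesis using D by (simp add: AE_ball_countable)
qed

end

section \<open>Measurable enumeration by pairs of rational endpoints\<close>

definition guarded_point :: "real \<Rightarrow> real \<Rightarrow> real \<Rightarrow> real option" where
  "guarded_point p q x = (if x \<in> {p<..<q} then Some x else None)"

lemma measurable_guarded_point: "guarded_point p q \<in> measurable borel borel_coffin"
  unfolding borel_coffin_def
proof (rule measurable_measure_of)
  fix Y :: "real option set" assume "Y \<in> {Some ` A | A. A \<in> sets borel} \<union> {{None}}"
  then consider A where "Y = Some ` A" "A \<in> sets borel" | "Y = {None}" by auto
  then show "guarded_point p q -` Y \<inter> space borel \<in> sets borel"
  proof cases
    case 1
    then have "guarded_point p q -` Y = A \<inter> {p<..<q}"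
      unfolding guarded_point_def by (auto split: if_splits)
    with 1 show ?thesis by simp
  next
    case 2
    then have "guarded_point p q -` Y = - {p<..<q}"
      unfolding guarded_point_def by (auto split: if_splits)
    then show ?thesis by (simp add: borel_comp)
  qed
qed auto

lemma space_borel_coffin: "space borel_coffin = UNIV"
  unfolding borel_coffin_def by (rule space_measure_of) simp

text \<open>Pairs that do not fit between \<open>s\<close> and \<open>t\<close> go to the coffin
  state for every path, so each term involves only last points measurable for the increments between
  \<open>s\<close> and \<open>t\<close>.\<close>

definition last_point_enumeration ::
    "((real \<Rightarrow> real) \<times> real) set \<Rightarrow> ereal \<Rightarrow> ereal \<Rightarrow> nat \<Rightarrow> (real \<Rightarrow> real) \<Rightarrow> real option" where
  "last_point_enumeration \<Gamma> s t i \<omega> = (case from_nat i :: rat \<times> rat of (p, q) \<Rightarrow>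
     if s \<le> ereal (of_rat p) \<and> p < q \<and> ereal (of_rat q) \<le> t
     then guarded_point (of_rat p) (of_rat q) (last_point \<Gamma> (of_rat p) (of_rat q) \<omega>) else None)"

lemma seq_set_last_point_enumeration:
  "seq_set (\<lambda>i. last_point_enumeration \<Gamma> s t i \<omega>) = {last_point \<Gamma> p q \<omega> | p q. p \<in> \<rat> \<and> q \<in> \<rat> \<and>
     s \<le> ereal p \<and> p < q \<and> ereal q \<le> t \<and> last_point \<Gamma> p q \<omega> \<in> {p<..<q}}"
    (is "_ = ?R")
proof (intro equalityI subsetI)
  fix x assume "x \<in> seq_set (\<lambda>i. last_point_enumeration \<Gamma> s t i \<omega>)"
  then obtain i where i: "Some x = last_point_enumeration \<Gamma> s t i \<omega>" unfolding seq_set_def by auto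
  obtain p q :: rat where pq: "from_nat i = (p, q)" by (cases "from_nat i :: rat \<times> rat")
  have "s \<le> ereal (of_rat p)" "p < q" "ereal (of_rat q) \<le> t"
    "last_point \<Gamma> (of_rat p) (of_rat q) \<omega> \<in> {of_rat p<..<of_rat q}"
    "x = last_point \<Gamma> (of_rat p) (of_rat q) \<omega>"
    using i unfolding last_point_enumeration_def pq guarded_point_def by (auto split: if_splits)
  then show "x \<in> ?R"
    by (intro CollectI exI[of _ "of_rat p"] exI[of _ "of_rat q"]) (simp add: of_rat_less)
next
  fix x assume "x \<in> ?R"
  then obtain p q where *: "p \<in> \<rat>" "q \<in> \<rat>" "s \<le> ereal p" "p < q" "ereal q \<le> t"
    "x = last_point \<Gamma> p q \<omega>" "x \<in> {p<..<q}" by blast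
  obtain p' q' where pq: "p = of_rat p'" "q = of_rat q'" using *(1,2) by (meson Rats_cases)
  have "Some x = last_point_enumeration \<Gamma> s t (to_nat (p', q')) \<omega>"
    using * unfolding last_point_enumeration_def guarded_point_def pq by (simp add: of_rat_less)
  then show "x \<in> seq_set (\<lambda>i. last_point_enumeration \<Gamma> s t i \<omega>)" unfolding seq_set_def by blast
qed

lemma (in two_sided_bm) last_point_enumeration_measurable:
  assumes "progressive \<W> \<Gamma>"
  shows "last_point_enumeration \<Gamma> s t i \<in> measurable (\<F> s t) borel_coffin"
proof -
  obtain p q :: rat where pq: "from_nat i = (p, q)" by (cases "from_nat i :: rat \<times> rat")
  have eq: "last_point_enumeration \<Gamma> s t i = (if s \<le> ereal (of_rat p) \<and> p < q \<and> ereal (of_rat q) \<le> t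
      then (\<lambda>\<omega>. guarded_point (of_rat p) (of_rat q) (last_point \<Gamma> (of_rat p) (of_rat q) \<omega>)) else (\<lambda>\<omega>. None))"
    by (rule ext) (auto simp: last_point_enumeration_def pq)
  show ?thesis
  proof (cases "s \<le> ereal (of_rat p) \<and> p < q \<and> ereal (of_rat q) \<le> t")
    case True
    then have "last_point \<Gamma> (of_rat p) (of_rat q) \<in> borel_measurable (\<F> s t)"
      using assms by (intro last_point_measurable) (auto simp: of_rat_less)
    from measurable_compose[OF this measurable_guarded_point] True show ?thesis
      unfolding eq by simp
  next
    case False
    then have "last_point_enumeration \<Gamma> s t i = (\<lambda>\<omega>. None)" unfolding eq by (rule if_not_P)
    then show ?thesis by (simp add: space_borel_coffin)
  qed
qed

section \<open>Locality and stationarity of the set of last points\<close>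

theorem proposition4p3:
  fixes W :: "(real \<Rightarrow> real) measure"
    and \<Gamma> :: "((real \<Rightarrow> real) \<times> real) set"
  assumes W: "completed_two_sided_wiener W"
    and \<Gamma>: "\<Gamma> \<subseteq> \<Omega>\<^sub>0 \<times> {0..}"
    and a: "AE \<omega> in W. 0 \<in> \<Gamma> `` {\<omega>}"
    and b: "AE \<omega> in W. closedin upper_limit_topology (\<Gamma> `` {\<omega>})"
    and c: "progressive W \<Gamma>"
    and d: "\<forall>u\<ge>0. AE \<omega> in W. \<forall>s. s \<in> \<Gamma> `` {\<omega>} \<inter> {u..} \<longrightarrow>
              \<Gamma> `` {\<omega>} \<inter> {s..} = (+) u ` (\<Gamma> `` {levy_shift u \<omega>}) \<inter> {s..}"
  shows "(\<forall>s t :: ereal. s < t \<longrightarrow>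
            (AE \<omega> in W. last_points \<Gamma> \<omega> \<inter> einterval s t =
               {last_point \<Gamma> p q \<omega> | p q. p \<in> \<rat> \<and> q \<in> \<rat> \<and>
                  s \<le> ereal p \<and> p < q \<and> ereal q \<le> t \<and> last_point \<Gamma> p q \<omega> \<in> {p<..<q}}))
         \<and> local_set W (last_points \<Gamma>)
         \<and> stationary_set W (last_points \<Gamma>)"
proof -
  obtain P where WP: "W = completion P" and P: "prob_space P" "space P = \<Omega>\<^sub>0" "sets P = sets path_borel"
      "standard_brownian_motion P (\<lambda>t \<omega>. \<omega> t)"
      "standard_brownian_motion P (\<lambda>t \<omega>. \<omega> (- t))"
      "prob_space.indep_var P
          (\<Pi>\<^sub>M t\<in>{0..}. borel) (\<lambda>\<omega>. \<lambda>t\<in>{0..}. \<omega> t)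
          (\<Pi>\<^sub>M t\<in>{0..}. borel) (\<lambda>\<omega>. \<lambda>t\<in>{0..}. \<omega> (- t))"
    using W unfolding completed_two_sided_wiener_def by blast
  interpret two_sided_bm P
    using P by (simp add: two_sided_bm_def two_sided_bm_axioms_def)
  note reg = AE_regular_between[OF a[unfolded WP] b[unfolded WP] d[unfolded WP]]
  have local_eq: "AE \<omega> in W. last_points \<Gamma> \<omega> \<inter> einterval s t =
      seq_set (\<lambda>i. last_point_enumeration \<Gamma> s t i \<omega>)" for s t
    using reg[OF countable_rat] unfolding WP
  proof eventually_elim
    fix \<omega> assume reg: "\<forall>p\<in>\<rat>. \<forall>q\<in>\<rat>. p < q \<longrightarrow> regular_between \<Gamma> \<omega> p q"
    show "last_points \<Gamma> \<omega> \<inter> einterval s t = seq_set (\<lambda>i. last_point_enumeration \<Gamma> s t i \<omega>)"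
      unfolding seq_set_last_point_enumeration
    proof (intro equalityI subsetI)
      fix x assume "x \<in> last_points \<Gamma> \<omega> \<inter> einterval s t"
      then obtain p q where pq: "p \<in> \<rat>" "q \<in> \<rat>" "p < x" "x < q" "x = last_point \<Gamma> p q \<omega>"
        and st: "s < ereal x" "ereal x < t"
        unfolding last_points_def einterval_def by auto
      \<comment> \<open>Maximum and minimum in the extended reals move both endpoints into the
        window at once, also when \<open>s\<close> or \<open>t\<close> is infinite.\<close>
      have "max s (ereal p) < ereal x" "ereal x < min t (ereal q)" using pq st by auto
      then obtain p' q' :: rat where p': "max s (ereal p) < ereal (of_rat p')" "ereal (of_rat p') < ereal x"
        and q': "ereal x < ereal (of_rat q')" "ereal (of_rat q') < min t (ereal q)"
        by (metis ereal_dense3)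
      then have "p < of_rat p'" "of_rat p' < x" "x < of_rat q'" "of_rat q' \<le> q" by auto
      then have "last_point \<Gamma> (of_rat p') (of_rat q') \<omega> = x"
        using reg pq by (intro last_point_localize[of _ _ p]) auto
      then show "x \<in> {last_point \<Gamma> p q \<omega> | p q. p \<in> \<rat> \<and> q \<in> \<rat> \<and>
          s \<le> ereal p \<and> p < q \<and> ereal q \<le> t \<and> last_point \<Gamma> p q \<omega> \<in> {p<..<q}}"
        using p' q' by (intro CollectI exI[of _ "of_rat p'"] exI[of _ "of_rat q'"]) auto
    next
      fix x assume "x \<in> {last_point \<Gamma> p q \<omega> | p q. p \<in> \<rat> \<and> q \<in> \<rat> \<and>
          s \<le> ereal p \<and> p < q \<and> ereal q \<le> t \<and> last_point \<Gamma> p q \<omega> \<in> {p<..<q}}"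
      then obtain p q where pq: "p \<in> \<rat>" "q \<in> \<rat>" "s \<le> ereal p" "p < q" "ereal q \<le> t"
        "x = last_point \<Gamma> p q \<omega>" "p < x" "x < q" by auto
      have "x \<in> last_points \<Gamma> \<omega>" unfolding last_points_def using pq
        by (intro CollectI exI[of _ p] exI[of _ q]) auto
      moreover have "s < ereal x" by (rule le_less_trans[OF pq(3)]) (use pq(7) in simp)
      moreover have "ereal x < t" by (rule less_le_trans[OF _ pq(5)]) (use pq(8) in simp)
      ultimately show "x \<in> last_points \<Gamma> \<omega> \<inter> einterval s t" by (simp add: einterval_def)
    qed
  qed
  have enum: "measurable_enumeration W (increments_field W s t) (\<lambda>\<omega>. last_points \<Gamma> \<omega> \<inter> einterval s t)
      (last_point_enumeration \<Gamma> s t)" for s t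
    unfolding measurable_enumeration_def
    using local_eq last_point_enumeration_measurable[OF c[unfolded WP]] unfolding WP by blast
  \<comment> \<open>For \<open>s = -\<infinity>\<close> and \<open>t = \<infinity>\<close> the
    window is the whole line, so the full set is enumerated, and the field of increments lies in the
    sets of \<open>W\<close>.\<close>
  have "measurable_enumeration W W (last_points \<Gamma>) (last_point_enumeration \<Gamma> (-\<infinity>) \<infinity>)"
    using enum[of "-\<infinity>" \<infinity>] measurable_from_subalg[OF subalgebra_increments]
    unfolding measurable_enumeration_def WP by (auto; blast)
  then have rcs: "random_countable_set W (last_points \<Gamma>)" unfolding random_countable_set_def by blast
  have "AE \<omega> in W. last_points \<Gamma> \<omega> = (+) u ` last_points \<Gamma> (levy_shift u \<omega>)" for u
  proof -
    let ?E = "(+) u ` (\<rat> :: real set)"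
    have dense: "\<exists>r\<in>?E. x < r \<and> r < y" if xy: "x < y" for x y
      using Rats_dense_in_real[of "x - u" "y - u"] xy by force
    \<comment> \<open>Both endpoint sets are joined because the two inclusions compare a rational
      time with a later translated one and conversely.\<close>
    have "AE \<omega> in W. \<forall>p\<in>\<rat> \<union> ?E. \<forall>q\<in>\<rat> \<union> ?E. p < q \<longrightarrow> regular_between \<Gamma> \<omega> p q"
      unfolding WP by (intro reg countable_Un countable_image countable_rat)
    then show ?thesis
    proof eventually_elim
      fix \<omega> assume reg: "\<forall>p\<in>\<rat> \<union> ?E. \<forall>q\<in>\<rat> \<union> ?E. p < q \<longrightarrow> regular_between \<Gamma> \<omega> p q"
      have "last_points_of \<Gamma> \<rat> \<omega> = last_points_of \<Gamma> ?E \<omega>"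
        using reg Rats_dense_in_real dense by (intro equalityI last_points_of_mono_dense) blast+
      then show "last_points \<Gamma> \<omega> = (+) u ` last_points \<Gamma> (levy_shift u \<omega>)"
        by (simp add: last_points_of_Rats levy_shift_last_points)
    qed
  qed
  with rcs have "stationary_set W (last_points \<Gamma>)" unfolding stationary_set_def by blast
  moreover have "local_set W (last_points \<Gamma>)" unfolding local_set_def using rcs enum by blast
  ultimately show ?thesis using local_eq unfolding seq_set_last_point_enumeration by blast
qed

end
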